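(* There is an absolute constant $C\ge 1$ (independent of $p$, $n$, $\Omega$ and the functions) such that the following holds. Let $(\Omega,\mathcal F,\mu)$ be a probability space, $n\in\mathbb N$, $1\le p<\infty$, and $f_{i,j}\in L^1(\Omega^2)$ for $i,j=1,\dots,n$. Put $$S(f)=\int_{\Omega^n}\int_{\Omega^n}\Big(\sum_{i,j}|f_{i,j}(x_i,y_j)|^p\Big)^{\frac1p}\,dx\,dy$$ and $$N(f)=\inf\left\{\|a\|_{(1)}+\|b\|_{(p)}+\|c\|_{(1,p)}+\|d\|_{(p,1)}\right\},$$ the infimum being over all families of measurable functions on $\Omega^2$ with $f_{i,j}=a_{i,j}+b_{i,j}+c_{i,j}+d_{i,j}$ for all $i,j$, where $$\|a\|_{(1)}=\sum_{i,j}\int_\Omega\int_\Omega|a_{i,j}(\xi,\upsilon)|\,d\xi\,d\upsilon,\qquad \|b\|_{(p)}=\Big(\sum_{i,j}\int_\Omega\int_\Omega|b_{i,j}(\xi,\upsilon)|^p\,d\xi\,d\upsilon\Big)^{\frac1p},$$ $$\|c\|_{(1,p)}=\sum_i\int_\Omega\Big(\sum_j\int_\Omega|c_{i,j}(\xi,\upsilon)|^p\,d\upsilon\Big)^{\frac1p}d\xi,\qquad \|d\|_{(p,1)}=\sum_j\int_\Omega\Big(\sum_i\int_\Omega|d_{i,j}(\xi,\upsilon)|^p\,d\xi\Big)^{\frac1p}d\upsilon .$$ Then $C^{-1}N(f)\le S(f)\le C\,N(f)$. Explicitly, the lower bound for $S(f)$ means that if $S(f)\le1$ then there is a decomposition $f_{i,j}=a_{i,j}+b_{i,j}+c_{i,j}+d_{i,j}$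 with each of $\|a\|_{(1)},\|b\|_{(p)},\|c\|_{(1,p)},\|d\|_{(p,1)}$ at most $C$. Moreover, this decomposition can be chosen so that for each $i,j$ the supports of $a_{i,j},b_{i,j},c_{i,j},d_{i,j}$ are (pairwise) disjoint.
   Context: $\Omega^n$ and $\Omega^2$ carry the product probability measures; $dx,d\xi$, etc. denote integration with respect to the relevant (product) measure. $x=(x_1,\dots,x_n)$ and $y=(y_1,\dots,y_n)$ denote points of $\Omega^n$. *)

theory Defs
  imports "HOL-Probability.Probability"
begin

text \<open>
  All quantities below take values in \<^typ>\<open>ennreal\<close>, so that they are meaningful without any
  integrability assumption. Functions on \<open>\<Omega>\<^sup>2\<close> are functions on pairs, and the families
  \<open>f i j\<close> are used only at the indices \<open>i, j \<in> {1..n}\<close>. The scalars are of class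
  \<^class>\<open>real_normed_field\<close> and \<^class>\<open>banach\<close>, i.e. the reals or the complex numbers.
\<close>

text \<open>The \<open>p\<close>-th root on \<open>[0,\<infinity>]\<close>, with \<open>\<infinity>\<close> as the root of \<open>\<infinity>\<close>.\<close>

definition ennroot :: "real \<Rightarrow> ennreal \<Rightarrow> ennreal" where
  "ennroot p x = (if x = \<infinity> then \<infinity> else ennreal (enn2real x powr (1 / p)))"

definition S_fun ::
  "'a measure \<Rightarrow> nat \<Rightarrow> real \<Rightarrow> (nat \<Rightarrow> nat \<Rightarrow> 'a \<times> 'a \<Rightarrow> 'k::real_normed_field) \<Rightarrow> ennreal" where
  "S_fun M n p f =
     (\<integral>\<^sup>+ x. (\<integral>\<^sup>+ y.
        ennreal ((\<Sum>i\<in>{1..n}. \<Sum>j\<in>{1..n}. norm (f i j (x i, y j)) powr p) powr (1 / p))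
      \<partial>Pi\<^sub>M {1..n} (\<lambda>_. M)) \<partial>Pi\<^sub>M {1..n} (\<lambda>_. M))"

definition norm_1 ::
  "'a measure \<Rightarrow> nat \<Rightarrow> (nat \<Rightarrow> nat \<Rightarrow> 'a \<times> 'a \<Rightarrow> 'k::real_normed_field) \<Rightarrow> ennreal" where
  "norm_1 M n a =
     (\<Sum>i\<in>{1..n}. \<Sum>j\<in>{1..n}. \<integral>\<^sup>+ \<xi>. (\<integral>\<^sup>+ \<upsilon>. ennreal (norm (a i j (\<xi>, \<upsilon>))) \<partial>M) \<partial>M)"

definition norm_p ::
  "'a measure \<Rightarrow> nat \<Rightarrow> real \<Rightarrow> (nat \<Rightarrow> nat \<Rightarrow> 'a \<times> 'a \<Rightarrow> 'k::real_normed_field) \<Rightarrow> ennreal" where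
  "norm_p M n p b =
     ennroot p (\<Sum>i\<in>{1..n}. \<Sum>j\<in>{1..n}.
        \<integral>\<^sup>+ \<xi>. (\<integral>\<^sup>+ \<upsilon>. ennreal (norm (b i j (\<xi>, \<upsilon>)) powr p) \<partial>M) \<partial>M)"

definition norm_1_p ::
  "'a measure \<Rightarrow> nat \<Rightarrow> real \<Rightarrow> (nat \<Rightarrow> nat \<Rightarrow> 'a \<times> 'a \<Rightarrow> 'k::real_normed_field) \<Rightarrow> ennreal" where
  "norm_1_p M n p c =
     (\<Sum>i\<in>{1..n}. \<integral>\<^sup>+ \<xi>.
        ennroot p (\<Sum>j\<in>{1..n}. \<integral>\<^sup>+ \<upsilon>. ennreal (norm (c i j (\<xi>, \<upsilon>)) powr p) \<partial>M) \<partial>M)"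

definition norm_p_1 ::
  "'a measure \<Rightarrow> nat \<Rightarrow> real \<Rightarrow> (nat \<Rightarrow> nat \<Rightarrow> 'a \<times> 'a \<Rightarrow> 'k::real_normed_field) \<Rightarrow> ennreal" where
  "norm_p_1 M n p d =
     (\<Sum>j\<in>{1..n}. \<integral>\<^sup>+ \<upsilon>.
        ennroot p (\<Sum>i\<in>{1..n}. \<integral>\<^sup>+ \<xi>. ennreal (norm (d i j (\<xi>, \<upsilon>)) powr p) \<partial>M) \<partial>M)"

text \<open>
  The identity \<open>f = a + b + c + d\<close> is required at every point, for the given representatives.
  Asking for it only almost everywhere would give the same infimum \<open>N_fun\<close> below, since a
  change on a null set can be absorbed into \<open>a\<close> without affecting any of the norms.
\<close>

definition is_decomp ::
  "'a measure \<Rightarrow> nat \<Rightarrow> (nat \<Rightarrow> nat \<Rightarrow> 'a \<times> 'a \<Rightarrow> 'k::real_normed_field) \<Rightarrow>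
   (nat \<Rightarrow> nat \<Rightarrow> 'a \<times> 'a \<Rightarrow> 'k) \<Rightarrow> (nat \<Rightarrow> nat \<Rightarrow> 'a \<times> 'a \<Rightarrow> 'k) \<Rightarrow>
   (nat \<Rightarrow> nat \<Rightarrow> 'a \<times> 'a \<Rightarrow> 'k) \<Rightarrow> (nat \<Rightarrow> nat \<Rightarrow> 'a \<times> 'a \<Rightarrow> 'k) \<Rightarrow> bool" where
  "is_decomp M n f a b c d \<longleftrightarrow>
     (\<forall>i\<in>{1..n}. \<forall>j\<in>{1..n}.
        a i j \<in> borel_measurable (M \<Otimes>\<^sub>M M) \<and> b i j \<in> borel_measurable (M \<Otimes>\<^sub>M M) \<and>
        c i j \<in> borel_measurable (M \<Otimes>\<^sub>M M) \<and> d i j \<in> borel_measurable (M \<Otimes>\<^sub>M M) \<and>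
        (\<forall>\<omega>\<in>space (M \<Otimes>\<^sub>M M). f i j \<omega> = a i j \<omega> + b i j \<omega> + c i j \<omega> + d i j \<omega>))"

definition N_fun ::
  "'a measure \<Rightarrow> nat \<Rightarrow> real \<Rightarrow> (nat \<Rightarrow> nat \<Rightarrow> 'a \<times> 'a \<Rightarrow> 'k::real_normed_field) \<Rightarrow> ennreal" where
  "N_fun M n p f =
     Inf {norm_1 M n a + norm_p M n p b + norm_1_p M n p c + norm_p_1 M n p d | a b c d.
            is_decomp M n f a b c d}"

definition supp_on :: "'a measure \<Rightarrow> ('a \<times> 'a \<Rightarrow> 'k::zero) \<Rightarrow> ('a \<times> 'a) set" where
  "supp_on M g = {\<omega> \<in> space (M \<Otimes>\<^sub>M M). g \<omega> \<noteq> 0}"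

definition disjoint_supports ::
  "'a measure \<Rightarrow> nat \<Rightarrow>
   (nat \<Rightarrow> nat \<Rightarrow> 'a \<times> 'a \<Rightarrow> 'k::real_normed_field) \<Rightarrow> (nat \<Rightarrow> nat \<Rightarrow> 'a \<times> 'a \<Rightarrow> 'k) \<Rightarrow>
   (nat \<Rightarrow> nat \<Rightarrow> 'a \<times> 'a \<Rightarrow> 'k) \<Rightarrow> (nat \<Rightarrow> nat \<Rightarrow> 'a \<times> 'a \<Rightarrow> 'k) \<Rightarrow> bool" where
  "disjoint_supports M n a b c d \<longleftrightarrow>
     (\<forall>i\<in>{1..n}. \<forall>j\<in>{1..n}.
        supp_on M (a i j) \<inter> supp_on M (b i j) = {} \<and>
        supp_on M (a i j) \<inter> supp_on M (c i j) = {} \<and>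
        supp_on M (a i j) \<inter> supp_on M (d i j) = {} \<and>
        supp_on M (b i j) \<inter> supp_on M (c i j) = {} \<and>
        supp_on M (b i j) \<inter> supp_on M (d i j) = {} \<and>
        supp_on M (c i j) \<inter> supp_on M (d i j) = {})"

text \<open>
  A generous numerical ceiling for the absolute constant. A constant \<open>C\<close> that is
  existentially quantified inside a theorem may depend on the type variables of the theorem,
  here the type of the points of \<open>\<Omega>\<close> and the scalar type. A common ceiling rules this out: all
  the assertions about \<open>C\<close> are monotone in \<open>C\<close>, so they then hold with one and the same constant
  for all types. The particular value has no significance.
\<close>

definition abs_const_ceiling :: real where
  "abs_const_ceiling = 10 ^ 6"

end

theory Submission
  imports Defs
begin

text \<open>
  Write \<open>r = 1 / p\<close> and let \<open>h i j\<close> be \<open>|f i j|\<^sup>p\<close> divided by \<open>L\<^sup>p\<close>, where \<open>L\<close> is \<open>32\<close> times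
  an upper bound of \<open>S(f)\<close>. Then \<open>\<integral>\<integral> (\<Sum> h i j (x i, y j)) powr r \<le> 1 / 32\<close>, and every estimate
  below is about the nonnegative array \<open>h\<close>; a bound by \<open>1\<close> on one of its pieces is a bound by
  \<open>L\<close> on the norm of the corresponding piece of \<open>f\<close>.

  The decomposition is a truncation. To each index \<open>i\<close> and point \<open>\<xi>\<close> belongs a level \<open>t\<close>, the
  least power \<open>2\<^sup>k \<ge> 1\<close> for which the row mass \<open>\<Sum>\<^sub>j \<integral> min (h i j (\<xi>, \<upsilon>) / t) 1 d\<upsilon>\<close> is at most
  \<open>1 / 4\<close>; each column has a level in the same way. The part \<open>a\<close> of \<open>f\<close> lives where \<open>h i j\<close>
  exceeds both levels (a peak), \<open>b\<close> where both levels are \<open>1\<close> and \<open>h i j \<le> 1\<close> (the bulk), \<open>c\<close>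
  where the row level is above \<open>1\<close> and not exceeded, and \<open>d\<close> where, outside that region,
  the same holds for the column level. These regions cover everything, and the bounds on the pieces are as follows.

  For the bulk and for a single row of high level the second moment method gives a lower bound for
  \<open>S(f)\<close>. The inequality \<open>min u 1 \<ge> l u - (l u)\<^sup>2 / 4\<close>, for \<open>u \<ge> 0\<close> and \<open>0 \<le> l \<le> 1\<close>,
  turns an upper bound for the second moment of a sum \<open>W\<close> into a lower bound for the mean of \<open>min W 1\<close>, hence for that of \<open>W powr r\<close>; since
  \<open>min u 1 \<le> u powr r\<close> for every \<open>r \<le> 1\<close>, the constants do not depend on \<open>p\<close>. The second
  moment is under control because the masses of rows and columns are small (\<open>cross_terms\<close>). This yields
  \<open>bulk_mass\<close> and, applied to the row of \<open>x i\<close> alone, \<open>row_level_le_aggregate\<close>.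

  Peaks, and rows of high level, are rare: even if one of them is present, with positive
  probability there is no other. The sum over all of them is therefore bounded by their maximum,
  which \<open>(\<Sum> h i j) powr r\<close> dominates up to a constant, pointwise or after integration over
  \<open>y\<close>, plus a proper fraction of the sum itself, which can be
  absorbed. This yields \<open>peaks\<close> and \<open>high_rows\<close>; transposing the array gives the columns.

  In the other direction, \<open>S(f)\<close> is at most four times the sum of \<open>S\<close> over the four pieces, and
  \<open>S(g)\<close> is at most each of the four norms of \<open>g\<close>, by the subadditivity of \<open>u powr r\<close> and Jensen's
  inequality.
\<close>

section \<open>Elementary inequalities\<close>

text \<open>After normalising the sum to \<open>1\<close>, every summand \<open>v\<close> lies in \<open>[0, 1]\<close>, where \<open>v \<le> v powr r\<close>.\<close>

lemma powr_sum_le_sum_powr: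
  fixes u :: "'b \<Rightarrow> real"
  assumes "finite A" and r: "0 < r" "r \<le> 1" and u: "\<And>a. a \<in> A \<Longrightarrow> 0 \<le> u a"
  shows "(\<Sum>a\<in>A. u a) powr r \<le> (\<Sum>a\<in>A. u a powr r)"
proof (cases "(\<Sum>a\<in>A. u a) = 0")
  case True
  then show ?thesis using r by (simp add: sum_nonneg)
next
  case False
  define s where "s = (\<Sum>a\<in>A. u a)"
  have s: "0 < s"
    using False sum_nonneg[of A u] u by (auto simp: s_def order_less_le)
  have "u a / s \<le> (u a / s) powr r" if "a \<in> A" for a
  proof (cases "u a = 0")
    case False
    have "u a \<le> s" unfolding s_def using assms(1) u that by (intro member_le_sum) auto
    moreover have "0 < u a" using False u[OF that] by simp
    ultimately have "(u a / s) powr 1 \<le> (u a / s) powr r"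
      using s r by (intro powr_mono') (auto simp: field_simps)
    then show ?thesis using u[OF that] s by simp
  qed (use r in simp)
  then have "(\<Sum>a\<in>A. u a / s) \<le> (\<Sum>a\<in>A. (u a / s) powr r)" by (rule sum_mono)
  moreover have "(\<Sum>a\<in>A. u a / s) = 1"
    using s by (simp add: sum_divide_distrib[symmetric] s_def)
  moreover have "(\<Sum>a\<in>A. (u a / s) powr r) = (\<Sum>a\<in>A. u a powr r) / s powr r"
    using s by (simp add: powr_divide u sum_divide_distrib)
  ultimately show ?thesis using s by (simp add: s_def[symmetric] pos_le_divide_eq)
qed

lemma min_one_le_powr:
  fixes u r :: real
  assumes "0 \<le> u" "0 < r" "r \<le> 1"
  shows "min u 1 \<le> u powr r"
proof (cases "u \<le> 1")
  case True
  show ?thesis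
  proof (cases "u = 0")
    case False
    then show ?thesis using powr_mono'[of r 1 u] assms True by simp
  qed (use assms in simp)
next
  case False
  then show ?thesis using ge_one_powr_ge_zero[of u r] assms by simp
qed

text \<open>The parabola \<open>v - v\<^sup>2 / 4\<close> has maximum \<open>1\<close>.\<close>

lemma scaled_le_min_plus_square:
  fixes u l :: real
  assumes "0 \<le> u" "0 \<le> l" "l \<le> 1"
  shows "l * u \<le> min u 1 + (l * u)\<^sup>2 / 4"
proof -
  have "0 \<le> (l * u / 2 - 1)\<^sup>2" by simp
  then have "l * u \<le> 1 + (l * u)\<^sup>2 / 4" by (simp add: power2_eq_square algebra_simps)
  moreover have "l * u \<le> u" using assms by (simp add: mult_left_le_one_le)
  ultimately show ?thesis by (smt (verit) zero_le_power2 divide_nonneg_nonneg)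
qed

text \<open>The finiteness of \<open>x\<close> is essential: \<open>x = \<top>\<close> satisfies every inequality \<open>x \<le> e + x q\<close>
  with \<open>q > 0\<close>.\<close>

lemma ennreal_absorb:
  fixes x :: ennreal
  assumes "x \<le> ennreal e + x * ennreal q" "x < \<top>" "0 \<le> e" "0 \<le> q" "q < 1"
  shows "x \<le> ennreal (e / (1 - q))"
proof -
  obtain z where z: "0 \<le> z" "x = ennreal z"
    using assms(2) by (cases x) auto
  have "z \<le> e + z * q"
    using assms z by (simp add: ennreal_mult'[symmetric] ennreal_plus[symmetric] del: ennreal_plus)
  then have "z \<le> e / (1 - q)" using assms by (simp add: field_simps)
  then show ?thesis using z assms by (simp add: ennreal_leI)
qed

lemma ennreal_scale_cancel:
  assumes "0 < c"
  shows "ennreal c * (ennreal (1 / c) * x) = x" "ennreal (1 / c) * (ennreal c * x) = x"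
  using assms by (simp_all add: mult.assoc[symmetric] ennreal_mult'[symmetric])

text \<open>A crude substitute for Minkowski's inequality, obtained by replacing every summand by the
  largest one.\<close>

lemma powr_add4_le:
  fixes a b c d p :: real
  assumes "0 \<le> a" "0 \<le> b" "0 \<le> c" "0 \<le> d" "1 \<le> p"
  shows "(a + b + c + d) powr p \<le> 4 powr p * (a powr p + b powr p + c powr p + d powr p)"
proof -
  define u where "u = max (max a b) (max c d)"
  have "(a + b + c + d) powr p \<le> (4 * u) powr p"
    using assms by (intro powr_mono2) (auto simp: u_def)
  also have "\<dots> = 4 powr p * u powr p" using assms by (simp add: powr_mult u_def)
  also have "u powr p \<le> a powr p + b powr p + c powr p + d powr p"
    by (auto simp: u_def max_def)
  finally show ?thesis by simp
qed

lemma powr_add4_subadditive: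
  fixes a b c d r :: real
  assumes "0 \<le> a" "0 \<le> b" "0 \<le> c" "0 \<le> d" "0 < r" "r \<le> 1"
  shows "(a + b + c + d) powr r \<le> a powr r + b powr r + c powr r + d powr r"
proof -
  have two: "(u + v) powr r \<le> u powr r + v powr r" if "0 \<le> u" "0 \<le> v" for u v :: real
    using powr_sum_le_sum_powr[of "UNIV :: bool set" r "\<lambda>t. if t then u else v"] that assms
    by (simp add: UNIV_bool add.commute)
  show ?thesis
    using two[of "a + b + c" d] two[of "a + b" c] two[of a b] assms by linarith
qed

lemma ennroot_le:
  assumes "X \<le> ennreal (z powr p)" "0 \<le> z" "0 < p"
  shows "ennroot p X \<le> ennreal z"
proof -
  obtain u where u: "0 \<le> u" "X = ennreal u" using assms(1) by (cases X) (auto simp: top_unique)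
  have "u powr (1 / p) \<le> (z powr p) powr (1 / p)"
    using assms u by (intro powr_mono2) (auto simp: ennreal_le_iff)
  also have "\<dots> = z" using assms by (simp add: powr_powr)
  finally show ?thesis using u by (simp add: ennroot_def ennreal_leI)
qed

text \<open>Jensen's inequality for the concave function \<open>y powr (1 / p)\<close>, by integrating its tangent
  at the mean. The tangent inequality is Young's inequality for \<open>y / m\<close> and \<open>1\<close>.\<close>

lemma (in prob_space) powr_mean_le_ennroot:
  fixes Y :: "'a \<Rightarrow> real"
  assumes [measurable]: "Y \<in> borel_measurable M" and Y: "\<And>x. 0 \<le> Y x" and p: "1 \<le> p"
  shows "(\<integral>\<^sup>+x. ennreal (Y x powr (1 / p)) \<partial>M) \<le> ennroot p (\<integral>\<^sup>+x. ennreal (Y x) \<partial>M)"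
proof (cases "\<integral>\<^sup>+x. ennreal (Y x) \<partial>M")
  case (real m)
  show ?thesis
  proof (cases "m = 0")
    case True
    then have "AE x in M. Y x = 0" 
    proof -
      have "AE x in M. ennreal (Y x) = 0"
        using True real by (subst nn_integral_0_iff_AE[symmetric]) auto
      then show ?thesis by eventually_elim (use Y in \<open>simp add: ennreal_eq_0_iff antisym\<close>)
    qed
    then have "(\<integral>\<^sup>+x. ennreal (Y x powr (1 / p)) \<partial>M) = (\<integral>\<^sup>+x. 0 \<partial>M)"
      using p by (intro nn_integral_cong_AE) auto
    then show ?thesis by simp
  next
    case False
    then have m: "0 < m" using real by simp
    have tangent: "Y x powr (1 / p) \<le> m powr (1 / p) * (1 - 1 / p) + m powr (1 / p) * (1 / p) / m * Y x" for x
    proof (cases "Y x = 0")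
      case False
      then have "0 < Y x" using Y[of x] by simp
      then have "(Y x / m) powr (1 / p) * 1 powr (1 - 1 / p) \<le> (1 / p) * (Y x / m) + (1 - 1 / p) * 1"
        using m p by (intro Youngs_inequality_0) (auto simp: field_simps)
      then have "(Y x / m) powr (1 / p) \<le> (1 - 1 / p) + (1 / p) * (Y x / m)" by simp
      then have "m powr (1 / p) * (Y x / m) powr (1 / p) \<le> m powr (1 / p) * ((1 - 1 / p) + (1 / p) * (Y x / m))"
        by (rule mult_left_mono) simp
      moreover have "m powr (1 / p) * (Y x / m) powr (1 / p) = Y x powr (1 / p)"
        using m Y[of x] by (simp add: powr_divide)
      ultimately show ?thesis by (simp add: algebra_simps)
    qed (use m p in simp)
    have "(\<integral>\<^sup>+x. ennreal (Y x powr (1 / p)) \<partial>M)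
      \<le> (\<integral>\<^sup>+x. ennreal (m powr (1 / p) * (1 - 1 / p)) + ennreal (m powr (1 / p) * (1 / p) / m) * ennreal (Y x) \<partial>M)"
    proof (rule nn_integral_mono)
      fix x
      show "ennreal (Y x powr (1 / p)) \<le> ennreal (m powr (1 / p) * (1 - 1 / p)) + ennreal (m powr (1 / p) * (1 / p) / m) * ennreal (Y x)"
        using ennreal_leI[OF tangent[of x]] m p Y[of x] by (simp add: ennreal_mult' del: times_divide_eq_left)
    qed
    also have "\<dots> = ennreal (m powr (1 / p) * (1 - 1 / p)) + ennreal (m powr (1 / p) * (1 / p) / m) * ennreal m"
      using real by (simp add: nn_integral_add nn_integral_cmult emeasure_space_1)
    also have "\<dots> = ennreal (m powr (1 / p) * (1 - 1 / p) + m powr (1 / p) * (1 / p) / m * m)"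
      using m p by (subst ennreal_plus) (auto simp: ennreal_mult'[symmetric])
    also have "m powr (1 / p) * (1 - 1 / p) + m powr (1 / p) * (1 / p) / m * m = m powr (1 / p)"
      using m by (simp add: algebra_simps)
    finally show ?thesis using real by (simp add: ennroot_def)
  qed
qed (simp add: ennroot_def)

text \<open>The second moment method: a variable with large mean \<open>m\<close> and controlled second moment cannot
  be concentrated near zero. The scaling \<open>l\<close> is left free, since the best choice is of order
  \<open>1 / (1 + m)\<close>.\<close>

lemma (in prob_space) mean_le_truncated_mean:
  fixes W :: "'a \<Rightarrow> real"
  assumes [measurable]: "W \<in> borel_measurable M" and W: "\<And>x. 0 \<le> W x"
    and m: "(\<integral>\<^sup>+x. ennreal (W x) \<partial>M) = ennreal m" "0 \<le> m"
    and v: "(\<integral>\<^sup>+x. ennreal ((W x)\<^sup>2) \<partial>M) \<le> ennreal v" "0 \<le> v"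
    and l: "0 \<le> l" "l \<le> 1"
  shows "ennreal (l * m) \<le> (\<integral>\<^sup>+x. ennreal (min (W x) 1) \<partial>M) + ennreal (l\<^sup>2 * v / 4)"
proof -
  have "ennreal (l * m) = (\<integral>\<^sup>+x. ennreal (l * W x) \<partial>M)"
    using m l W by (simp add: ennreal_mult' nn_integral_cmult)
  also have "\<dots> \<le> (\<integral>\<^sup>+x. ennreal (min (W x) 1) + ennreal (l\<^sup>2 / 4) * ennreal ((W x)\<^sup>2) \<partial>M)"
    using scaled_le_min_plus_square[OF W l] W
    by (intro nn_integral_mono)
      (auto simp: ennreal_plus[symmetric] ennreal_mult'[symmetric] power_mult_distrib simp del: ennreal_plus intro!: ennreal_leI)
  also have "\<dots> = (\<integral>\<^sup>+x. ennreal (min (W x) 1) \<partial>M) + ennreal (l\<^sup>2 / 4) * (\<integral>\<^sup>+x. ennreal ((W x)\<^sup>2) \<partial>M)"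
    by (simp add: nn_integral_add nn_integral_cmult)
  also have "\<dots> \<le> (\<integral>\<^sup>+x. ennreal (min (W x) 1) \<partial>M) + ennreal (l\<^sup>2 / 4) * ennreal v"
    by (intro add_left_mono mult_left_mono v) auto
  also have "ennreal (l\<^sup>2 / 4) * ennreal v = ennreal (l\<^sup>2 * v / 4)"
    using v by (simp add: ennreal_mult'[symmetric])
  finally show ?thesis .
qed

section \<open>Resampling coordinates of a product space\<close>

text \<open>Independence is used only through integrals over \<open>M\<^sup>I\<close> in which single coordinates are
  replaced by fresh ones.\<close>

locale coordinate_space = prob_space M for M :: "'a measure" +
  fixes I :: "'i set"
  assumes finite_I: "finite I"
begin

abbreviation P :: "('i \<Rightarrow> 'a) measure" where
  "P \<equiv> Pi\<^sub>M I (\<lambda>_. M)"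

sublocale P: prob_space P
  by (intro prob_space_PiM prob_space_axioms)

sublocale PS: product_sigma_finite "\<lambda>_::'i. M"
  by standard

sublocale MP: pair_sigma_finite M P ..
sublocale PP: pair_prob_space P P ..

lemma measurable_upd [measurable]:
  assumes "i \<in> I" "g \<in> measurable N P" "h \<in> measurable N M"
  shows "(\<lambda>w. (g w)(i := h w)) \<in> measurable N P"
  using assms by (intro measurable_fun_upd[where J=I]) auto

lemma space_upd:
  assumes "x \<in> space P" "\<xi> \<in> space M" "i \<in> I"
  shows "x(i := \<xi>) \<in> space P"
  using assms by (auto simp: space_PiM PiE_def Pi_def extensional_def)

lemma space_component: "x \<in> space P \<Longrightarrow> i \<in> I \<Longrightarrow> x i \<in> space M"
  by (auto simp: space_PiM)

text \<open>Replacing the \<open>i\<close>-th coordinate by an independent copy does not change the distribution. If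
  \<open>G x\<close> is a function of \<open>x i\<close> times a function of the other coordinates, this says that the
  two factors are independent.\<close>

lemma resample:
  assumes i: "i \<in> I" and G [measurable]: "G \<in> borel_measurable P"
  shows "(\<integral>\<^sup>+x. G x \<partial>P) = (\<integral>\<^sup>+\<xi>. (\<integral>\<^sup>+x. G (x(i := \<xi>)) \<partial>P) \<partial>M)"
proof -
  define J where "J = I - {i}"
  have J: "finite J" "i \<notin> J" "I = insert i J" using i finite_I by (auto simp: J_def)
  interpret J: prob_space "Pi\<^sub>M J (\<lambda>_. M)" by (intro prob_space_PiM prob_space_axioms)
  have G': "G \<in> borel_measurable (Pi\<^sub>M (insert i J) (\<lambda>_. M))" using J(3) G by simp
  have *: "(\<integral>\<^sup>+x. G (x(i := \<xi>)) \<partial>P) = (\<integral>\<^sup>+x. G (x(i := \<xi>)) \<partial>Pi\<^sub>M J (\<lambda>_. M))"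
    if [measurable]: "\<xi> \<in> space M" for \<xi>
  proof -
    have m: "(\<lambda>x. G (x(i := \<xi>))) \<in> borel_measurable (Pi\<^sub>M (insert i J) (\<lambda>_. M))"
      unfolding J(3)[symmetric] using i by measurable
    have "(\<integral>\<^sup>+x. G (x(i := \<xi>)) \<partial>P)
        = (\<integral>\<^sup>+x. (\<integral>\<^sup>+z. G ((x(i := z))(i := \<xi>)) \<partial>M) \<partial>Pi\<^sub>M J (\<lambda>_. M))"
      using PS.product_nn_integral_insert[OF J(1,2) m] J(3) by simp
    also have "\<dots> = (\<integral>\<^sup>+x. G (x(i := \<xi>)) \<partial>Pi\<^sub>M J (\<lambda>_. M))"
      by (simp add: emeasure_space_1)
    finally show ?thesis .
  qed
  have "(\<integral>\<^sup>+x. G x \<partial>P) = (\<integral>\<^sup>+\<xi>. (\<integral>\<^sup>+x. G (x(i := \<xi>)) \<partial>Pi\<^sub>M J (\<lambda>_. M)) \<partial>M)"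
    using PS.product_nn_integral_insert_rev[OF J(1,2) G'] J(3) by simp
  also have "\<dots> = (\<integral>\<^sup>+\<xi>. (\<integral>\<^sup>+x. G (x(i := \<xi>)) \<partial>P) \<partial>M)"
    by (intro nn_integral_cong) (simp add: *)
  finally show ?thesis .
qed

lemma nn_integral_component:
  assumes i: "i \<in> I" and [measurable]: "g \<in> borel_measurable M"
  shows "(\<integral>\<^sup>+x. g (x i) \<partial>P) = (\<integral>\<^sup>+\<xi>. g \<xi> \<partial>M)"
  using i by (subst resample[OF i]) (auto simp: P.emeasure_space_1)

lemma resample2:
  assumes i: "i \<in> I" and j: "j \<in> I" and G [measurable]: "case_prod G \<in> borel_measurable (P \<Otimes>\<^sub>M P)"
  shows "(\<integral>\<^sup>+x. (\<integral>\<^sup>+y. G x y \<partial>P) \<partial>P)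
    = (\<integral>\<^sup>+\<xi>. (\<integral>\<^sup>+\<upsilon>. (\<integral>\<^sup>+x. (\<integral>\<^sup>+y. G (x(i := \<xi>)) (y(j := \<upsilon>)) \<partial>P) \<partial>P) \<partial>M) \<partial>M)"
proof -
  have [measurable]: "(\<lambda>w. G (f w) (g w)) \<in> borel_measurable N"
    if "f \<in> measurable N P" "g \<in> measurable N P" for f g and N :: "'c measure"
    using measurable_compose[OF measurable_Pair[OF that] G] by simp
  have [measurable]: "G x \<in> borel_measurable P" if "x \<in> space P" for x
    using measurable_compose_Pair1[OF that G] by simp
  note [measurable] = i j
  have "(\<integral>\<^sup>+x. (\<integral>\<^sup>+y. G x y \<partial>P) \<partial>P) = (\<integral>\<^sup>+\<xi>. (\<integral>\<^sup>+x. (\<integral>\<^sup>+y. G (x(i := \<xi>)) y \<partial>P) \<partial>P) \<partial>M)"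
    by (rule resample[OF i]) measurable
  also have "\<dots> = (\<integral>\<^sup>+\<xi>. (\<integral>\<^sup>+x. (\<integral>\<^sup>+\<upsilon>. (\<integral>\<^sup>+y. G (x(i := \<xi>)) (y(j := \<upsilon>)) \<partial>P) \<partial>M) \<partial>P) \<partial>M)"
    by (intro nn_integral_cong resample[OF j]) (use space_upd i in auto)
  also have "\<dots> = (\<integral>\<^sup>+\<xi>. (\<integral>\<^sup>+\<upsilon>. (\<integral>\<^sup>+x. (\<integral>\<^sup>+y. G (x(i := \<xi>)) (y(j := \<upsilon>)) \<partial>P) \<partial>P) \<partial>M) \<partial>M)"
  proof (intro nn_integral_cong MP.Fubini')
    fix \<xi> assume [measurable]: "\<xi> \<in> space M"
    show "(\<lambda>(u, x). \<integral>\<^sup>+y. G (x(i := \<xi>)) (y(j := u)) \<partial>P) \<in> borel_measurable (M \<Otimes>\<^sub>M P)"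
      by measurable
  qed
  finally show ?thesis .
qed

lemma mean_row:
  assumes w [measurable]: "\<And>j. j \<in> I \<Longrightarrow> w j \<in> borel_measurable M" and w0: "\<And>j \<upsilon>. 0 \<le> (w j \<upsilon> :: real)"
  shows "(\<integral>\<^sup>+y. ennreal (\<Sum>j\<in>I. w j (y j)) \<partial>P) = (\<Sum>j\<in>I. \<integral>\<^sup>+\<upsilon>. ennreal (w j \<upsilon>) \<partial>M)"
proof -
  have "(\<integral>\<^sup>+y. ennreal (\<Sum>j\<in>I. w j (y j)) \<partial>P) = (\<Sum>j\<in>I. \<integral>\<^sup>+y. ennreal (w j (y j)) \<partial>P)"
    using w0 by (simp add: sum_ennreal[symmetric] nn_integral_sum del: sum_ennreal)
  also have "\<dots> = (\<Sum>j\<in>I. \<integral>\<^sup>+\<upsilon>. ennreal (w j \<upsilon>) \<partial>M)"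
    by (intro sum.cong nn_integral_component) auto
  finally show ?thesis .
qed

lemma integral_entry:
  assumes i [measurable]: "i \<in> I" and j [measurable]: "j \<in> I"
    and [measurable]: "g \<in> borel_measurable (M \<Otimes>\<^sub>M M)"
  shows "(\<integral>\<^sup>+x. (\<integral>\<^sup>+y. g (x i, y j) \<partial>P) \<partial>P) = (\<integral>\<^sup>+\<xi>. (\<integral>\<^sup>+\<upsilon>. g (\<xi>, \<upsilon>) \<partial>M) \<partial>M)"
  by (subst resample2[OF i j]) (auto simp: P.emeasure_space_1)

lemma integral2_add:
  assumes F [measurable]: "case_prod F \<in> borel_measurable (P \<Otimes>\<^sub>M P)"
    and G [measurable]: "case_prod G \<in> borel_measurable (P \<Otimes>\<^sub>M P)"
  shows "(\<integral>\<^sup>+x. (\<integral>\<^sup>+y. F x y + G x y \<partial>P) \<partial>P)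
    = (\<integral>\<^sup>+x. (\<integral>\<^sup>+y. F x y \<partial>P) \<partial>P) + (\<integral>\<^sup>+x. (\<integral>\<^sup>+y. G x y \<partial>P) \<partial>P)"
proof -
  have [measurable]: "F x \<in> borel_measurable P" "G x \<in> borel_measurable P" if "x \<in> space P" for x
    using measurable_compose_Pair1[OF that F] measurable_compose_Pair1[OF that G] by simp_all
  show ?thesis by (simp add: nn_integral_add cong: nn_integral_cong)
qed

lemma integral2_cmult:
  assumes G [measurable]: "case_prod G \<in> borel_measurable (P \<Otimes>\<^sub>M P)"
  shows "(\<integral>\<^sup>+x. (\<integral>\<^sup>+y. c * G x y \<partial>P) \<partial>P) = c * (\<integral>\<^sup>+x. (\<integral>\<^sup>+y. G x y \<partial>P) \<partial>P)"
proof -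
  have [measurable]: "G x \<in> borel_measurable P" if "x \<in> space P" for x
    using measurable_compose_Pair1[OF that G] by simp
  show ?thesis by (simp add: nn_integral_cmult cong: nn_integral_cong)
qed

lemma entry_integral_cmult:
  assumes [measurable]: "g \<in> borel_measurable (M \<Otimes>\<^sub>M M)"
  shows "(\<integral>\<^sup>+\<xi>. (\<integral>\<^sup>+\<upsilon>. c * g (\<xi>, \<upsilon>) \<partial>M) \<partial>M) = c * (\<integral>\<^sup>+\<xi>. (\<integral>\<^sup>+\<upsilon>. g (\<xi>, \<upsilon>) \<partial>M) \<partial>M)"
  by (simp add: nn_integral_cmult cong: nn_integral_cong)

lemma integral_double_sum:
  assumes [measurable]: "\<And>i j. i \<in> I \<Longrightarrow> j \<in> I \<Longrightarrow> case_prod (G i j) \<in> borel_measurable (P \<Otimes>\<^sub>M P)"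
  shows "(\<integral>\<^sup>+x. (\<integral>\<^sup>+y. (\<Sum>i\<in>I. \<Sum>j\<in>I. G i j x y) \<partial>P) \<partial>P)
    = (\<Sum>i\<in>I. \<Sum>j\<in>I. \<integral>\<^sup>+x. (\<integral>\<^sup>+y. G i j x y \<partial>P) \<partial>P)"
proof -
  have [measurable]: "G i j x \<in> borel_measurable P" if [measurable]: "i \<in> I" "j \<in> I" "x \<in> space P" for i j x
    using measurable_compose_Pair1[of x P "case_prod (G i j)" P borel] by simp
  have "(\<integral>\<^sup>+x. (\<integral>\<^sup>+y. (\<Sum>i\<in>I. \<Sum>j\<in>I. G i j x y) \<partial>P) \<partial>P) = (\<integral>\<^sup>+x. (\<Sum>i\<in>I. \<Sum>j\<in>I. \<integral>\<^sup>+y. G i j x y \<partial>P) \<partial>P)"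
  proof (rule nn_integral_cong)
    fix x assume [measurable]: "x \<in> space P"
    have "(\<integral>\<^sup>+y. (\<Sum>i\<in>I. \<Sum>j\<in>I. G i j x y) \<partial>P) = (\<Sum>i\<in>I. \<integral>\<^sup>+y. (\<Sum>j\<in>I. G i j x y) \<partial>P)"
      by (rule nn_integral_sum) measurable
    also have "\<dots> = (\<Sum>i\<in>I. \<Sum>j\<in>I. \<integral>\<^sup>+y. G i j x y \<partial>P)"
      by (intro sum.cong refl nn_integral_sum) measurable
    finally show "(\<integral>\<^sup>+y. (\<Sum>i\<in>I. \<Sum>j\<in>I. G i j x y) \<partial>P) = (\<Sum>i\<in>I. \<Sum>j\<in>I. \<integral>\<^sup>+y. G i j x y \<partial>P)" .
  qed
  also have "\<dots> = (\<Sum>i\<in>I. \<integral>\<^sup>+x. (\<Sum>j\<in>I. \<integral>\<^sup>+y. G i j x y \<partial>P) \<partial>P)"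
    by (rule nn_integral_sum) measurable
  also have "\<dots> = (\<Sum>i\<in>I. \<Sum>j\<in>I. \<integral>\<^sup>+x. (\<integral>\<^sup>+y. G i j x y \<partial>P) \<partial>P)"
    by (intro sum.cong refl nn_integral_sum) measurable
  finally show ?thesis .
qed

text \<open>Expand one factor of the square. Resampling the coordinate \<open>j\<close> makes \<open>w j\<close> independent of
  all other summands, and the remaining diagonal summand is at most \<open>1\<close>.\<close>

lemma second_moment_row:
  assumes w [measurable]: "\<And>j. j \<in> I \<Longrightarrow> w j \<in> borel_measurable M"
    and w01: "\<And>j \<upsilon>. 0 \<le> w j \<upsilon>" "\<And>j \<upsilon>. w j \<upsilon> \<le> (1::real)"
    and m: "(\<Sum>j\<in>I. \<integral>\<^sup>+\<upsilon>. ennreal (w j \<upsilon>) \<partial>M) = ennreal m" "0 \<le> m"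
  shows "(\<integral>\<^sup>+y. ennreal ((\<Sum>j\<in>I. w j (y j))\<^sup>2) \<partial>P) \<le> ennreal (m * (1 + m))"
proof -
  have mean: "(\<integral>\<^sup>+y. ennreal (\<Sum>j\<in>I. w j (y j)) \<partial>P) = ennreal m"
    using mean_row[OF w w01(1)] m by simp
  have "ennreal ((\<Sum>j\<in>I. w j (y j))\<^sup>2) = (\<Sum>j\<in>I. ennreal (w j (y j)) * ennreal (\<Sum>l\<in>I. w l (y l)))" for y
    using w01 by (simp add: power2_eq_square sum_distrib_right ennreal_mult' sum_ennreal[symmetric] sum_nonneg del: sum_ennreal)
  then have "(\<integral>\<^sup>+y. ennreal ((\<Sum>j\<in>I. w j (y j))\<^sup>2) \<partial>P)
      = (\<Sum>j\<in>I. \<integral>\<^sup>+y. ennreal (w j (y j)) * ennreal (\<Sum>l\<in>I. w l (y l)) \<partial>P)"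
    by (simp add: nn_integral_sum)
  also have "\<dots> \<le> (\<Sum>j\<in>I. (\<integral>\<^sup>+\<upsilon>. ennreal (w j \<upsilon>) \<partial>M) * ennreal (1 + m))"
  proof (rule sum_mono)
    fix j assume j: "j \<in> I"
    note [measurable] = j
    have pt: "(\<Sum>l\<in>I. w l ((y(j := \<upsilon>)) l)) \<le> 1 + (\<Sum>l\<in>I. w l (y l))" for y \<upsilon>
    proof -
      have "(\<Sum>l\<in>I. w l ((y(j := \<upsilon>)) l)) = w j \<upsilon> + (\<Sum>l\<in>I-{j}. w l ((y(j := \<upsilon>)) l))"
        using finite_I j by (subst sum.remove[of _ j]) auto
      also have "(\<Sum>l\<in>I-{j}. w l ((y(j := \<upsilon>)) l)) = (\<Sum>l\<in>I-{j}. w l (y l))"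
        by (intro sum.cong) auto
      also have "\<dots> \<le> (\<Sum>l\<in>I. w l (y l))" using w01 finite_I by (intro sum_mono2) auto
      finally show ?thesis using w01(2)[of j \<upsilon>] by linarith
    qed
    have "(\<integral>\<^sup>+y. ennreal (w j (y j)) * ennreal (\<Sum>l\<in>I. w l (y l)) \<partial>P)
      = (\<integral>\<^sup>+\<upsilon>. (\<integral>\<^sup>+y. ennreal (w j \<upsilon>) * ennreal (\<Sum>l\<in>I. w l ((y(j := \<upsilon>)) l)) \<partial>P) \<partial>M)"
      by (subst resample[OF j]) auto
    also have "\<dots> \<le> (\<integral>\<^sup>+\<upsilon>. (\<integral>\<^sup>+y. ennreal (w j \<upsilon>) * (1 + ennreal (\<Sum>l\<in>I. w l (y l))) \<partial>P) \<partial>M)"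
      using w01 by (intro nn_integral_mono mult_left_mono)
        (auto simp: ennreal_1[symmetric] ennreal_plus[symmetric] sum_nonneg simp del: ennreal_1 ennreal_plus
              intro!: ennreal_leI pt[unfolded fun_upd_apply])
    also have "\<dots> = (\<integral>\<^sup>+\<upsilon>. ennreal (w j \<upsilon>) * ennreal (1 + m) \<partial>M)"
      using m by (simp add: nn_integral_cmult nn_integral_add mean P.emeasure_space_1)
    also have "\<dots> = (\<integral>\<^sup>+\<upsilon>. ennreal (w j \<upsilon>) \<partial>M) * ennreal (1 + m)"
      by (simp add: nn_integral_multc)
    finally show "(\<integral>\<^sup>+y. ennreal (w j (y j)) * ennreal (\<Sum>l\<in>I. w l (y l)) \<partial>P)
        \<le> (\<integral>\<^sup>+\<upsilon>. ennreal (w j \<upsilon>) \<partial>M) * ennreal (1 + m)" .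
  qed
  also have "\<dots> = ennreal (m * (1 + m))"
    using m by (simp add: sum_distrib_right[symmetric] ennreal_mult')
  finally show ?thesis .
qed

section \<open>Levels of rows and columns\<close>

definition row_mass :: "('i \<Rightarrow> 'i \<Rightarrow> 'a \<times> 'a \<Rightarrow> real) \<Rightarrow> real \<Rightarrow> 'i \<Rightarrow> 'a \<Rightarrow> ennreal" where
  "row_mass h t i \<xi> = (\<Sum>j\<in>I. \<integral>\<^sup>+\<upsilon>. ennreal (min (h i j (\<xi>, \<upsilon>) / t) 1) \<partial>M)"

text \<open>Restricting the levels to powers of \<open>2\<close> makes them minima over a countable set, and
  therefore measurable; the price is a factor \<open>2\<close> in \<open>row_mass_at_high_level\<close>.\<close>

definition row_level :: "('i \<Rightarrow> 'i \<Rightarrow> 'a \<times> 'a \<Rightarrow> real) \<Rightarrow> 'i \<Rightarrow> 'a \<Rightarrow> real" where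
  "row_level h i \<xi> = 2 ^ (LEAST k. row_mass h (2 ^ k) i \<xi> \<le> ennreal (1 / 4))"

definition transposed :: "('i \<Rightarrow> 'i \<Rightarrow> 'a \<times> 'a \<Rightarrow> real) \<Rightarrow> 'i \<Rightarrow> 'i \<Rightarrow> 'a \<times> 'a \<Rightarrow> real" where
  "transposed h i j z = h j i (snd z, fst z)"

definition col_level :: "('i \<Rightarrow> 'i \<Rightarrow> 'a \<times> 'a \<Rightarrow> real) \<Rightarrow> 'i \<Rightarrow> 'a \<Rightarrow> real" where
  "col_level h = row_level (transposed h)"

definition aggregate :: "real \<Rightarrow> ('i \<Rightarrow> 'i \<Rightarrow> 'a \<times> 'a \<Rightarrow> real) \<Rightarrow> ('i \<Rightarrow> 'a) \<Rightarrow> ('i \<Rightarrow> 'a) \<Rightarrow> real" where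
  "aggregate r h x y = (\<Sum>i\<in>I. \<Sum>j\<in>I. h i j (x i, y j)) powr r"

definition peak :: "('i \<Rightarrow> 'i \<Rightarrow> 'a \<times> 'a \<Rightarrow> real) \<Rightarrow> 'i \<Rightarrow> 'i \<Rightarrow> 'a \<times> 'a \<Rightarrow> bool" where
  "peak h i j z \<longleftrightarrow> row_level h i (fst z) < h i j z \<and> col_level h j (snd z) < h i j z"

definition bulk :: "('i \<Rightarrow> 'i \<Rightarrow> 'a \<times> 'a \<Rightarrow> real) \<Rightarrow> 'i \<Rightarrow> 'i \<Rightarrow> 'a \<times> 'a \<Rightarrow> bool" where
  "bulk h i j z \<longleftrightarrow> row_level h i (fst z) = 1 \<and> col_level h j (snd z) = 1 \<and> h i j z \<le> 1"

end

locale random_array = coordinate_space M I for M :: "'a measure" and I :: "'i set" +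
  fixes h :: "'i \<Rightarrow> 'i \<Rightarrow> 'a \<times> 'a \<Rightarrow> real" and r :: real
  assumes h_measurable [measurable]:
      "\<And>i j. i \<in> I \<Longrightarrow> j \<in> I \<Longrightarrow> h i j \<in> borel_measurable (M \<Otimes>\<^sub>M M)"
    and h_nonneg: "\<And>i j z. 0 \<le> h i j z"
    and r: "0 < r" "r \<le> 1"
begin

lemma random_array_transposed: "random_array M I (transposed h) r"
proof
  fix i j assume [measurable]: "i \<in> I" "j \<in> I"
  show "transposed h i j \<in> borel_measurable (M \<Otimes>\<^sub>M M)"
    unfolding transposed_def by measurable
qed (auto simp: transposed_def h_nonneg r)

lemma row_level_ge_1: "1 \<le> row_level g i \<xi>"
  by (simp add: row_level_def)

lemma row_mass_measurable [measurable]: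
  assumes [measurable]: "i \<in> I" shows "row_mass h t i \<in> borel_measurable M"
  unfolding row_mass_def by measurable

lemma row_level_measurable [measurable]:
  assumes [measurable]: "i \<in> I" shows "row_level h i \<in> borel_measurable M"
  unfolding row_level_def by measurable

lemma col_level_measurable [measurable]:
  assumes "i \<in> I" shows "col_level h i \<in> borel_measurable M"
proof -
  interpret T: random_array M I "transposed h" r by (rule random_array_transposed)
  show ?thesis unfolding col_level_def using assms by measurable
qed

text \<open>The truncated entries are bounded by \<open>1\<close> and tend to \<open>0\<close> pointwise as the level grows, so
  this is dominated convergence.\<close>

lemma small_row_mass_exists:
  assumes [measurable]: "i \<in> I" "\<xi> \<in> space M"
  shows "\<exists>k. row_mass h (2 ^ k) i \<xi> \<le> ennreal (1 / 4)"
proof -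
  have "(\<lambda>k. \<integral>\<^sup>+\<upsilon>. ennreal (min (h i j (\<xi>, \<upsilon>) / 2 ^ k) 1) \<partial>M) \<longlonglongrightarrow> (\<integral>\<^sup>+\<upsilon>. 0 \<partial>M)"
    if [measurable]: "j \<in> I" for j
  proof (rule nn_integral_dominated_convergence[where w="\<lambda>_. 1"])
    have "(\<lambda>k. ennreal (min (c / 2 ^ k) 1)) \<longlonglongrightarrow> 0" for c :: real
    proof -
      have "(\<lambda>k. c * (1 / 2) ^ k) \<longlonglongrightarrow> c * 0"
        by (intro tendsto_mult tendsto_const LIMSEQ_power_zero) simp
      then have "(\<lambda>k. ennreal (min (c / 2 ^ k) 1)) \<longlonglongrightarrow> ennreal (min 0 1)"
        by (intro tendsto_ennrealI tendsto_min tendsto_const) (simp add: power_one_over field_simps)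
      then show ?thesis by simp
    qed
    then show "AE \<upsilon> in M. (\<lambda>k. ennreal (min (h i j (\<xi>, \<upsilon>) / 2 ^ k) 1)) \<longlonglongrightarrow> 0" by simp
  qed (auto simp: emeasure_space_1)
  then have "(\<lambda>k. row_mass h (2 ^ k) i \<xi>) \<longlonglongrightarrow> (\<Sum>j\<in>I. \<integral>\<^sup>+\<upsilon>. 0 \<partial>M)"
    unfolding row_mass_def by (intro tendsto_sum)
  then have "eventually (\<lambda>k. row_mass h (2 ^ k) i \<xi> < ennreal (1 / 4)) sequentially"
    by (intro order_tendstoD(2)) auto
  then show ?thesis by (meson eventually_sequentially less_imp_le order_refl)
qed

lemma row_mass_at_level:
  assumes "i \<in> I" "\<xi> \<in> space M"
  shows "row_mass h (row_level h i \<xi>) i \<xi> \<le> ennreal (1 / 4)"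
  unfolding row_level_def by (rule LeastI_ex[OF small_row_mass_exists[OF assms]])

text \<open>A level above \<open>1\<close> was not attained one step earlier, so half of it still carries mass more
  than \<open>1 / 4\<close>; doubling a level at most halves the mass.\<close>

lemma row_mass_at_high_level:
  assumes i [measurable]: "i \<in> I" and \<xi> [measurable]: "\<xi> \<in> space M" and "1 < row_level h i \<xi>"
  shows "ennreal (1 / 8) \<le> row_mass h (row_level h i \<xi>) i \<xi>"
proof -
  define k where "k = (LEAST k. row_mass h (2 ^ k) i \<xi> \<le> ennreal (1 / 4))"
  have t: "row_level h i \<xi> = 2 ^ k" by (simp add: k_def row_level_def)
  then obtain l where l: "k = Suc l" using assms by (cases k) auto
  have "\<not> row_mass h (2 ^ l) i \<xi> \<le> ennreal (1 / 4)"
    using not_less_Least[of l "\<lambda>k. row_mass h (2 ^ k) i \<xi> \<le> ennreal (1 / 4)"] l by (simp add: k_def[symmetric])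
  then have "ennreal (1 / 2) * ennreal (1 / 4) \<le> ennreal (1 / 2) * row_mass h (2 ^ l) i \<xi>"
    by (intro mult_left_mono) auto
  also have "\<dots> = (\<Sum>j\<in>I. ennreal (1 / 2) * (\<integral>\<^sup>+\<upsilon>. ennreal (min (h i j (\<xi>, \<upsilon>) / 2 ^ l) 1) \<partial>M))"
    by (simp add: row_mass_def sum_distrib_left)
  also have "\<dots> \<le> row_mass h (2 ^ k) i \<xi>"
    unfolding row_mass_def
  proof (rule sum_mono)
    fix j assume "j \<in> I"
    have "ennreal (1 / 2) * (\<integral>\<^sup>+\<upsilon>. ennreal (min (h i j (\<xi>, \<upsilon>) / 2 ^ l) 1) \<partial>M)
        \<le> (\<integral>\<^sup>+\<upsilon>. ennreal (1 / 2) * ennreal (min (h i j (\<xi>, \<upsilon>) / 2 ^ l) 1) \<partial>M)"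
      using \<open>j \<in> I\<close> i \<xi> by (subst nn_integral_cmult) auto
    also have "\<dots> \<le> (\<integral>\<^sup>+\<upsilon>. ennreal (min (h i j (\<xi>, \<upsilon>) / 2 ^ k) 1) \<partial>M)"
    proof (rule nn_integral_mono)
      fix \<upsilon>
      have "1 / 2 * min (c / 2 ^ l) 1 \<le> min (c / 2 ^ k) 1" if "0 \<le> c" for c :: real
        using that by (auto simp: l min_def field_simps)
      from this[OF h_nonneg]
      show "ennreal (1 / 2) * ennreal (min (h i j (\<xi>, \<upsilon>) / 2 ^ l) 1) \<le> ennreal (min (h i j (\<xi>, \<upsilon>) / 2 ^ k) 1)"
        by (subst ennreal_mult'[symmetric]) (auto intro!: ennreal_leI)
    qed
    finally show "ennreal (1 / 2) * (\<integral>\<^sup>+\<upsilon>. ennreal (min (h i j (\<xi>, \<upsilon>) / 2 ^ l) 1) \<partial>M)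
        \<le> (\<integral>\<^sup>+\<upsilon>. ennreal (min (h i j (\<xi>, \<upsilon>) / 2 ^ k) 1) \<partial>M)" .
  qed
  also have "ennreal (1 / 2) * ennreal (1 / 4) = ennreal (1 / 8)"
    by (subst ennreal_mult'[symmetric]) auto
  finally show ?thesis by (simp add: t)
qed

lemma aggregate_measurable [measurable]:
  "case_prod (aggregate r h) \<in> borel_measurable (P \<Otimes>\<^sub>M P)"
  unfolding aggregate_def by measurable

lemma aggregate_measurable_right [measurable]:
  "x \<in> space P \<Longrightarrow> aggregate r h x \<in> borel_measurable P"
  using measurable_compose_Pair1[OF _ aggregate_measurable] by simp

lemma row_le_aggregate:
  assumes "i \<in> I"
  shows "(\<Sum>j\<in>I. h i j (x i, y j)) powr r \<le> aggregate r h x y"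
  unfolding aggregate_def using r finite_I h_nonneg assms
  by (intro powr_mono2 member_le_sum[where f="\<lambda>i. \<Sum>j\<in>I. h i j (x i, y j)"]) (auto intro: sum_nonneg)

lemma entry_le_aggregate:
  assumes "i \<in> I" "j \<in> I"
  shows "h i j (x i, y j) powr r \<le> aggregate r h x y"
proof -
  have "h i j (x i, y j) powr r \<le> (\<Sum>j\<in>I. h i j (x i, y j)) powr r"
    using r finite_I h_nonneg assms
    by (intro powr_mono2 member_le_sum[where f="\<lambda>j. h i j (x i, y j)"]) auto
  then show ?thesis using row_le_aggregate[OF assms(1)] by (rule order_trans)
qed

lemma aggregate_transposed: "aggregate r (transposed h) y x = aggregate r h x y"
  unfolding aggregate_def transposed_def by (subst sum.swap) simp

lemma integral_aggregate_transposed: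
  "(\<integral>\<^sup>+x. (\<integral>\<^sup>+y. ennreal (aggregate r (transposed h) x y) \<partial>P) \<partial>P)
    = (\<integral>\<^sup>+x. (\<integral>\<^sup>+y. ennreal (aggregate r h x y) \<partial>P) \<partial>P)"
  unfolding aggregate_transposed by (rule PP.Fubini') simp

section \<open>Rows of high level\<close>

text \<open>Fix \<open>x\<close>. After division by the level \<open>t\<close> the truncated row of \<open>x i\<close> is a sum of independent
  variables in \<open>[0, 1]\<close> whose mean lies between \<open>1 / 8\<close> and \<open>1 / 4\<close>, so the second moment
  method bounds the mean of its \<open>r\<close>-th power from below by \<open>1 / 16\<close>.\<close>

lemma row_level_le_aggregate:
  assumes i [measurable]: "i \<in> I" and x: "x \<in> space P" and t1: "1 < row_level h i (x i)"
  shows "ennreal (row_level h i (x i) powr r) \<le> 16 * (\<integral>\<^sup>+y. ennreal (aggregate r h x y) \<partial>P)"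
proof -
  have xi [measurable]: "x i \<in> space M" using x i by (rule space_component)
  define t where "t = row_level h i (x i)"
  have t: "1 < t" using t1 by (simp add: t_def)
  define w where "w j \<upsilon> = min (h i j (x i, \<upsilon>) / t) 1" for j \<upsilon>
  have w [measurable]: "w j \<in> borel_measurable M" if [measurable]: "j \<in> I" for j
    unfolding w_def by measurable
  have w01: "0 \<le> w j \<upsilon>" "w j \<upsilon> \<le> 1" for j \<upsilon> using t h_nonneg by (auto simp: w_def)
  define m where "m = enn2real (row_mass h t i (x i))"
  have mass: "(\<Sum>j\<in>I. \<integral>\<^sup>+\<upsilon>. ennreal (w j \<upsilon>) \<partial>M) = row_mass h t i (x i)"
    by (simp add: row_mass_def w_def)
  have upper: "row_mass h t i (x i) \<le> ennreal (1 / 4)"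
    unfolding t_def using i xi by (rule row_mass_at_level)
  then have m: "(\<Sum>j\<in>I. \<integral>\<^sup>+\<upsilon>. ennreal (w j \<upsilon>) \<partial>M) = ennreal m" "0 \<le> m"
    unfolding m_def mass by (auto simp: ennreal_enn2real_if top_unique)
  have m4: "m \<le> 1 / 4" using upper m by (simp add: mass)
  have m8: "1 / 8 \<le> m"
    using row_mass_at_high_level[OF i xi t1] m(1) by (simp add: mass t_def[symmetric] ennreal_le_iff2)
  define W where "W y = (\<Sum>j\<in>I. w j (y j))" for y
  have [measurable]: "W \<in> borel_measurable P" unfolding W_def by measurable
  have W0: "0 \<le> W y" for y unfolding W_def using w01 by (intro sum_nonneg) auto
  have mean: "(\<integral>\<^sup>+y. ennreal (W y) \<partial>P) = ennreal m"
    unfolding W_def using mean_row[OF w w01(1)] m by simp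
  have "ennreal (1 * m) \<le> (\<integral>\<^sup>+y. ennreal (min (W y) 1) \<partial>P) + ennreal (1\<^sup>2 * (m * (1 + m)) / 4)"
    using second_moment_row[OF w w01 m] m W0 mean
    by (intro P.mean_le_truncated_mean) (auto simp: W_def[abs_def])
  then have "ennreal (1 / 16) \<le> (\<integral>\<^sup>+y. ennreal (min (W y) 1) \<partial>P)"
  proof (cases "\<integral>\<^sup>+y. ennreal (min (W y) 1) \<partial>P")
    case (real e)
    have "m * (1 + m) \<le> m * (5 / 4)" using m m4 by (intro mult_left_mono) auto
    moreover assume "ennreal (1 * m) \<le> (\<integral>\<^sup>+y. ennreal (min (W y) 1) \<partial>P) + ennreal (1\<^sup>2 * (m * (1 + m)) / 4)"
    then have "m \<le> e + m * (1 + m) / 4"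
      using real m by (simp add: ennreal_plus[symmetric] del: ennreal_plus)
    ultimately have "1 / 16 \<le> e" using m8 by linarith
    then show ?thesis using real by (simp add: ennreal_leI)
  qed simp
  then have "ennreal (t powr r) * ennreal (1 / 16)
      \<le> ennreal (t powr r) * (\<integral>\<^sup>+y. ennreal (min (W y) 1) \<partial>P)"
    by (rule mult_left_mono) simp
  also have "\<dots> = (\<integral>\<^sup>+y. ennreal (t powr r * min (W y) 1) \<partial>P)"
    by (simp add: nn_integral_cmult[symmetric] ennreal_mult')
  also have "\<dots> \<le> (\<integral>\<^sup>+y. ennreal (aggregate r h x y) \<partial>P)"
  proof (intro nn_integral_mono ennreal_leI)
    fix y
    have "t powr r * min (W y) 1 \<le> t powr r * W y powr r"
      using min_one_le_powr[OF W0 r] by (intro mult_left_mono) auto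
    also have "\<dots> = (t * W y) powr r" using t W0 by (simp add: powr_mult)
    also have "t * W y \<le> (\<Sum>j\<in>I. h i j (x i, y j))"
      unfolding W_def sum_distrib_left using t by (intro sum_mono) (auto simp: w_def min_def field_simps)
    then have "(t * W y) powr r \<le> (\<Sum>j\<in>I. h i j (x i, y j)) powr r"
      using t W0 r by (intro powr_mono2) auto
    also have "\<dots> \<le> aggregate r h x y" by (rule row_le_aggregate[OF i])
    finally show "t powr r * min (W y) 1 \<le> aggregate r h x y" .
  qed
  finally have "16 * (ennreal (t powr r) * ennreal (1 / 16)) \<le> 16 * (\<integral>\<^sup>+y. ennreal (aggregate r h x y) \<partial>P)"
    by (rule mult_left_mono) simp
  moreover have "16 * (ennreal (t powr r) * ennreal (1 / 16)) = ennreal (t powr r)"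
  proof -
    have "16 * (ennreal (t powr r) * ennreal (1 / 16)) = ennreal 16 * ennreal (t powr r * (1 / 16))"
      by (subst ennreal_mult') auto
    also have "\<dots> = ennreal (t powr r)" by (subst ennreal_mult'[symmetric]) auto
    finally show ?thesis .
  qed
  ultimately show ?thesis by (simp add: t_def)
qed

text \<open>The presence of one high row costs at least \<open>1 / 16\<close> in the integral, so by Markov's inequality
  it has probability at most \<open>1 / 2\<close>. Hence with probability at least \<open>1 / 2\<close> a given high row is
  the only one.\<close>

lemma high_rows:
  assumes S: "(\<integral>\<^sup>+x. (\<integral>\<^sup>+y. ennreal (aggregate r h x y) \<partial>P) \<partial>P) \<le> ennreal (1 / 32)"
  shows "(\<Sum>i\<in>I. \<integral>\<^sup>+\<xi>. ennreal (if 1 < row_level h i \<xi> then row_level h i \<xi> powr r else 0) \<partial>M) \<le> 1"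
proof -
  define Z where "Z i \<xi> = ennreal (if 1 < row_level h i \<xi> then row_level h i \<xi> powr r else 0)" for i \<xi>
  have [measurable]: "Z i \<in> borel_measurable M" if [measurable]: "i \<in> I" for i
    unfolding Z_def by measurable
  define T where "T x = 16 * (\<integral>\<^sup>+y. ennreal (aggregate r h x y) \<partial>P)" for x
  have [measurable]: "T \<in> borel_measurable P" unfolding T_def by measurable
  define X where "X = (\<Sum>i\<in>I. \<integral>\<^sup>+\<xi>. Z i \<xi> \<partial>M)"
  define other where "other i x = (of_bool (\<exists>k\<in>I. k \<noteq> i \<and> 1 < row_level h k (x k)) :: ennreal)" for i x
  define some where "some x = (of_bool (\<exists>k\<in>I. 1 < row_level h k (x k)) :: ennreal)" for x
  note fin [measurable, simp] = countable_finite[OF finite_I]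
  have [measurable]: "other i \<in> borel_measurable P" for i
    unfolding other_def of_bool_def using finite_I by measurable
  have [measurable]: "some \<in> borel_measurable P"
    unfolding some_def of_bool_def using finite_I by measurable
  have intT: "(\<integral>\<^sup>+x. T x \<partial>P) \<le> ennreal (1 / 2)"
  proof -
    have "(\<integral>\<^sup>+x. T x \<partial>P) \<le> 16 * ennreal (1 / 32)"
      unfolding T_def by (subst nn_integral_cmult) (auto intro!: mult_left_mono S)
    also have "\<dots> = ennreal (1 / 2)" by (simp add: ennreal_numeral[symmetric] ennreal_mult'[symmetric] del: ennreal_numeral)
    finally show ?thesis .
  qed
  have Z_le_T: "Z i (x i) \<le> T x" if "i \<in> I" "x \<in> space P" for i x
    using row_level_le_aggregate[OF that] by (auto simp: Z_def T_def)
  have high_ge_1: "1 \<le> Z i \<xi>" if "1 < row_level h i \<xi>" for i \<xi>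
    using that ge_one_powr_ge_zero[of "row_level h i \<xi>" r] r
    by (auto simp: Z_def ennreal_1[symmetric] simp del: ennreal_1 intro!: ennreal_leI)
  have int_Z: "(\<integral>\<^sup>+x. Z i (x i) \<partial>P) = (\<integral>\<^sup>+\<xi>. Z i \<xi> \<partial>M)" if "i \<in> I" for i
    using that by (intro nn_integral_component) auto
  have finite: "X < \<top>"
  proof -
    have "(\<integral>\<^sup>+\<xi>. Z i \<xi> \<partial>M) < \<top>" if "i \<in> I" for i
    proof -
      have "(\<integral>\<^sup>+x. Z i (x i) \<partial>P) \<le> (\<integral>\<^sup>+x. T x \<partial>P)"
        using that by (intro nn_integral_mono Z_le_T)
      also have "\<dots> < \<top>" by (rule order.strict_trans1[OF intT ennreal_less_top])
      finally show ?thesis using int_Z[OF that] by simp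
    qed
    then show ?thesis unfolding X_def using finite_I by (simp add: less_top)
  qed
  have some_le: "(\<integral>\<^sup>+x. some x \<partial>P) \<le> ennreal (1 / 2)"
  proof -
    have "some x \<le> T x" if "x \<in> space P" for x
      using Z_le_T[OF _ that] high_ge_1 by (auto simp: some_def intro: order_trans)
    then have "(\<integral>\<^sup>+x. some x \<partial>P) \<le> (\<integral>\<^sup>+x. T x \<partial>P)" by (intro nn_integral_mono)
    then show ?thesis using intT by (rule order_trans)
  qed
  \<comment> \<open>Either some high row is the only one, and it is paid for by \<open>T\<close>, or every high row sees another.\<close>
  have pointwise: "(\<Sum>i\<in>I. Z i (x i)) \<le> T x + (\<Sum>i\<in>I. Z i (x i) * other i x)" if x: "x \<in> space P" for x
  proof (cases "\<exists>i\<in>I. Z i (x i) \<noteq> 0 \<and> other i x = 0")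
    case True
    then obtain i where i: "i \<in> I" "other i x = 0" by auto
    then have "Z k (x k) = 0" if "k \<in> I - {i}" for k
      using that by (auto simp: other_def Z_def split: if_splits)
    then have "(\<Sum>i\<in>I. Z i (x i)) = Z i (x i)"
      using i finite_I by (subst sum.remove[of _ i]) auto
    also have "\<dots> \<le> T x" using i x by (intro Z_le_T)
    finally show ?thesis by (simp add: add_increasing2)
  next
    case False
    then have "Z i (x i) \<le> Z i (x i) * other i x" if "i \<in> I" for i
      using that by (auto simp: other_def)
    then have "(\<Sum>i\<in>I. Z i (x i)) \<le> (\<Sum>i\<in>I. Z i (x i) * other i x)" by (rule sum_mono)
    then show ?thesis by (simp add: add_increasing)
  qed
  \<comment> \<open>The event that another row is high does not depend on the \<open>i\<close>-th coordinate.\<close>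
  have cross: "(\<integral>\<^sup>+x. Z i (x i) * other i x \<partial>P) \<le> (\<integral>\<^sup>+\<xi>. Z i \<xi> \<partial>M) * ennreal (1 / 2)" if i [measurable]: "i \<in> I" for i
  proof -
    have le: "other i (x(i := \<xi>)) \<le> some x" for x \<xi>
      by (auto simp: other_def some_def of_bool_def)
    have "(\<integral>\<^sup>+x. Z i (x i) * other i x \<partial>P) = (\<integral>\<^sup>+\<xi>. (\<integral>\<^sup>+x. Z i \<xi> * other i (x(i := \<xi>)) \<partial>P) \<partial>M)"
      by (subst resample[OF i]) auto
    also have "\<dots> \<le> (\<integral>\<^sup>+\<xi>. (\<integral>\<^sup>+x. Z i \<xi> * some x \<partial>P) \<partial>M)"
      by (intro nn_integral_mono mult_left_mono le) simp
    also have "\<dots> = (\<integral>\<^sup>+\<xi>. Z i \<xi> * (\<integral>\<^sup>+x. some x \<partial>P) \<partial>M)" by (simp add: nn_integral_cmult)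
    also have "\<dots> = (\<integral>\<^sup>+\<xi>. Z i \<xi> \<partial>M) * (\<integral>\<^sup>+x. some x \<partial>P)" by (simp add: nn_integral_multc)
    also have "\<dots> \<le> (\<integral>\<^sup>+\<xi>. Z i \<xi> \<partial>M) * ennreal (1 / 2)" by (intro mult_left_mono some_le) simp
    finally show ?thesis .
  qed
  have "X = (\<integral>\<^sup>+x. (\<Sum>i\<in>I. Z i (x i)) \<partial>P)"
    unfolding X_def by (simp add: nn_integral_sum int_Z)
  also have "\<dots> \<le> (\<integral>\<^sup>+x. T x + (\<Sum>i\<in>I. Z i (x i) * other i x) \<partial>P)"
    by (intro nn_integral_mono pointwise)
  also have "\<dots> = (\<integral>\<^sup>+x. T x \<partial>P) + (\<Sum>i\<in>I. \<integral>\<^sup>+x. Z i (x i) * other i x \<partial>P)"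
    by (simp add: nn_integral_add nn_integral_sum)
  also have "\<dots> \<le> ennreal (1 / 2) + (\<Sum>i\<in>I. (\<integral>\<^sup>+\<xi>. Z i \<xi> \<partial>M) * ennreal (1 / 2))"
    by (intro add_mono intT sum_mono cross)
  also have "\<dots> = ennreal (1 / 2) + X * ennreal (1 / 2)"
    by (simp add: X_def sum_distrib_right)
  finally have "X \<le> ennreal ((1 / 2) / (1 - 1 / 2))"
    by (rule ennreal_absorb) (use finite in auto)
  then show ?thesis by (simp add: X_def Z_def)
qed

section \<open>Peaks and bulk\<close>

lemma peak_measurable [measurable]:
  assumes [measurable]: "i \<in> I" "j \<in> I"
  shows "Measurable.pred (M \<Otimes>\<^sub>M M) (peak h i j)"
  unfolding peak_def by measurable

lemma bulk_measurable [measurable]: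
  assumes [measurable]: "i \<in> I" "j \<in> I"
  shows "Measurable.pred (M \<Otimes>\<^sub>M M) (bulk h i j)"
  unfolding bulk_def by measurable

text \<open>The quantity \<open>\<Phi>\<close> collects what interacts with the entry at \<open>(i, j)\<close>. Once the coordinates
  \<open>x i = \<xi>\<close> and \<open>y j = \<upsilon>\<close> are frozen, it is dominated by a constant, by entries in the row of
  \<open>\<xi>\<close> and the column of \<open>\<upsilon>\<close>, each of total mass at most \<open>1 / 4\<close> by the choice of the levels,
  and by a term \<open>Q\<close> that is independent of \<open>(\<xi>, \<upsilon>)\<close>. The same estimate serves for the second
  moment of the bulk and for the probability that a peak is not the only one.\<close>

lemma cross_terms:
  fixes Z :: "'a \<times> 'a \<Rightarrow> ennreal" and V :: "'i \<Rightarrow> 'i \<Rightarrow> 'a \<times> 'a \<Rightarrow> ennreal"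
  assumes i [measurable]: "i \<in> I" and j [measurable]: "j \<in> I"
    and Z [measurable]: "Z \<in> borel_measurable (M \<Otimes>\<^sub>M M)"
    and V [measurable]: "\<And>k l. k \<in> I \<Longrightarrow> l \<in> I \<Longrightarrow> V k l \<in> borel_measurable (M \<Otimes>\<^sub>M M)"
    and \<Phi> [measurable]: "case_prod \<Phi> \<in> borel_measurable (P \<Otimes>\<^sub>M P)"
    and Q [measurable]: "case_prod Q \<in> borel_measurable (P \<Otimes>\<^sub>M P)"
    and row: "\<And>k l z. V k l z \<le> ennreal (min (h k l z / row_level h k (fst z)) 1)"
    and col: "\<And>k l z. V k l z \<le> ennreal (min (h k l z / col_level h l (snd z)) 1)"
    and bound: "\<And>\<xi> \<upsilon> x y. \<Phi> (x(i := \<xi>)) (y(j := \<upsilon>))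
      \<le> \<alpha> + (\<Sum>l\<in>I. V i l (\<xi>, y l)) + (\<Sum>k\<in>I. V k j (x k, \<upsilon>)) + Q x y"
  shows "(\<integral>\<^sup>+x. (\<integral>\<^sup>+y. Z (x i, y j) * \<Phi> x y \<partial>P) \<partial>P)
    \<le> (\<integral>\<^sup>+\<xi>. (\<integral>\<^sup>+\<upsilon>. Z (\<xi>, \<upsilon>) \<partial>M) \<partial>M)
        * (\<alpha> + ennreal (1 / 4) + ennreal (1 / 4) + (\<integral>\<^sup>+x. (\<integral>\<^sup>+y. Q x y \<partial>P) \<partial>P))"
proof -
  interpret T: random_array M I "transposed h" r by (rule random_array_transposed)
  define q where "q = (\<integral>\<^sup>+x. (\<integral>\<^sup>+y. Q x y \<partial>P) \<partial>P)"
  have [measurable]: "Q x \<in> borel_measurable P" if "x \<in> space P" for x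
    using measurable_compose_Pair1[OF that Q] by simp
  have [measurable]: "(\<lambda>w. \<Phi> (f w) (g w)) \<in> borel_measurable N"
    if "f \<in> measurable N P" "g \<in> measurable N P" for f g and N :: "'c measure"
    using measurable_compose[OF measurable_Pair[OF that] \<Phi>] by simp
  have rows: "(\<integral>\<^sup>+y. (\<Sum>l\<in>I. V i l (\<xi>, y l)) \<partial>P) \<le> ennreal (1 / 4)"
    if \<xi> [measurable]: "\<xi> \<in> space M" for \<xi>
  proof -
    have "(\<integral>\<^sup>+y. (\<Sum>l\<in>I. V i l (\<xi>, y l)) \<partial>P) = (\<Sum>l\<in>I. \<integral>\<^sup>+y. V i l (\<xi>, y l) \<partial>P)"
      by (simp add: nn_integral_sum)
    also have "\<dots> = (\<Sum>l\<in>I. \<integral>\<^sup>+\<upsilon>. V i l (\<xi>, \<upsilon>) \<partial>M)"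
      by (intro sum.cong nn_integral_component) auto
    also have "\<dots> \<le> row_mass h (row_level h i \<xi>) i \<xi>"
      unfolding row_mass_def using row[of i _ "(\<xi>, _)"] by (intro sum_mono nn_integral_mono) auto
    also have "\<dots> \<le> ennreal (1 / 4)" by (rule row_mass_at_level[OF i \<xi>])
    finally show ?thesis .
  qed
  have cols: "(\<integral>\<^sup>+x. (\<Sum>k\<in>I. V k j (x k, \<upsilon>)) \<partial>P) \<le> ennreal (1 / 4)"
    if \<upsilon> [measurable]: "\<upsilon> \<in> space M" for \<upsilon>
  proof -
    have "(\<integral>\<^sup>+x. (\<Sum>k\<in>I. V k j (x k, \<upsilon>)) \<partial>P) = (\<Sum>k\<in>I. \<integral>\<^sup>+x. V k j (x k, \<upsilon>) \<partial>P)"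
      by (simp add: nn_integral_sum)
    also have "\<dots> = (\<Sum>k\<in>I. \<integral>\<^sup>+\<xi>. V k j (\<xi>, \<upsilon>) \<partial>M)"
      by (intro sum.cong nn_integral_component) auto
    also have "\<dots> \<le> row_mass (transposed h) (row_level (transposed h) j \<upsilon>) j \<upsilon>"
      unfolding row_mass_def using col[of _ j "(_, \<upsilon>)"]
      by (intro sum_mono nn_integral_mono) (auto simp: transposed_def[abs_def] col_level_def)
    also have "\<dots> \<le> ennreal (1 / 4)" by (rule T.row_mass_at_level[OF j \<upsilon>])
    finally show ?thesis .
  qed
  have inner: "(\<integral>\<^sup>+x. (\<integral>\<^sup>+y. \<Phi> (x(i := \<xi>)) (y(j := \<upsilon>)) \<partial>P) \<partial>P) \<le> \<alpha> + ennreal (1 / 4) + ennreal (1 / 4) + q"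
    if [measurable]: "\<xi> \<in> space M" "\<upsilon> \<in> space M" for \<xi> \<upsilon>
  proof -
    have "(\<integral>\<^sup>+x. (\<integral>\<^sup>+y. \<Phi> (x(i := \<xi>)) (y(j := \<upsilon>)) \<partial>P) \<partial>P)
      \<le> (\<integral>\<^sup>+x. (\<integral>\<^sup>+y. \<alpha> + (\<Sum>l\<in>I. V i l (\<xi>, y l)) + (\<Sum>k\<in>I. V k j (x k, \<upsilon>)) + Q x y \<partial>P) \<partial>P)"
      by (intro nn_integral_mono bound)
    also have "\<dots> = (\<integral>\<^sup>+x. \<alpha> + (\<integral>\<^sup>+y. (\<Sum>l\<in>I. V i l (\<xi>, y l)) \<partial>P) + (\<Sum>k\<in>I. V k j (x k, \<upsilon>)) + (\<integral>\<^sup>+y. Q x y \<partial>P) \<partial>P)"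
      by (intro nn_integral_cong) (simp add: nn_integral_add P.emeasure_space_1)
    also have "\<dots> = \<alpha> + (\<integral>\<^sup>+y. (\<Sum>l\<in>I. V i l (\<xi>, y l)) \<partial>P) + (\<integral>\<^sup>+x. (\<Sum>k\<in>I. V k j (x k, \<upsilon>)) \<partial>P) + q"
      by (simp add: nn_integral_add P.emeasure_space_1 q_def)
    also have "\<dots> \<le> \<alpha> + ennreal (1 / 4) + ennreal (1 / 4) + q"
      using that by (intro add_mono rows cols) auto
    finally show ?thesis .
  qed
  have "(\<integral>\<^sup>+x. (\<integral>\<^sup>+y. Z (x i, y j) * \<Phi> x y \<partial>P) \<partial>P)
    = (\<integral>\<^sup>+\<xi>. (\<integral>\<^sup>+\<upsilon>. (\<integral>\<^sup>+x. (\<integral>\<^sup>+y. Z (\<xi>, \<upsilon>) * \<Phi> (x(i := \<xi>)) (y(j := \<upsilon>)) \<partial>P) \<partial>P) \<partial>M) \<partial>M)"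
    by (subst resample2[OF i j]) auto
  also have "\<dots> = (\<integral>\<^sup>+\<xi>. (\<integral>\<^sup>+\<upsilon>. Z (\<xi>, \<upsilon>) * (\<integral>\<^sup>+x. (\<integral>\<^sup>+y. \<Phi> (x(i := \<xi>)) (y(j := \<upsilon>)) \<partial>P) \<partial>P) \<partial>M) \<partial>M)"
    by (simp add: nn_integral_cmult cong: nn_integral_cong)
  also have "\<dots> \<le> (\<integral>\<^sup>+\<xi>. (\<integral>\<^sup>+\<upsilon>. Z (\<xi>, \<upsilon>) * (\<alpha> + ennreal (1 / 4) + ennreal (1 / 4) + q) \<partial>M) \<partial>M)"
    by (intro nn_integral_mono mult_left_mono inner) auto
  also have "\<dots> = (\<integral>\<^sup>+\<xi>. (\<integral>\<^sup>+\<upsilon>. Z (\<xi>, \<upsilon>) \<partial>M) \<partial>M) * (\<alpha> + ennreal (1 / 4) + ennreal (1 / 4) + q)"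
    by (simp add: nn_integral_multc cong: nn_integral_cong)
  finally show ?thesis by (simp add: q_def)
qed

text \<open>Given a peak at \<open>(i, j)\<close>, the expected number of further peaks in its row or its column is
  at most \<open>1 / 4\<close> each, and a peak elsewhere has probability at most \<open>1 / 32\<close>, because the entry at a
  peak exceeds \<open>1\<close>. So a given peak is the only one with probability at least \<open>15 / 32\<close>. Absorbing
  the remaining fraction of the sum requires it to be finite, hence the integrability assumption.\<close>

lemma peaks:
  assumes S: "(\<integral>\<^sup>+x. (\<integral>\<^sup>+y. ennreal (aggregate r h x y) \<partial>P) \<partial>P) \<le> ennreal (1 / 32)"
    and fin: "\<And>i j. i \<in> I \<Longrightarrow> j \<in> I \<Longrightarrow> (\<integral>\<^sup>+\<xi>. (\<integral>\<^sup>+\<upsilon>. ennreal (h i j (\<xi>, \<upsilon>) powr r) \<partial>M) \<partial>M) < \<top>"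
  shows "(\<Sum>i\<in>I. \<Sum>j\<in>I. \<integral>\<^sup>+\<xi>. (\<integral>\<^sup>+\<upsilon>. ennreal (if peak h i j (\<xi>, \<upsilon>) then h i j (\<xi>, \<upsilon>) powr r else 0) \<partial>M) \<partial>M) \<le> 1"
proof -
  define Z where "Z i j z = ennreal (if peak h i j z then h i j z powr r else 0)" for i j z
  have [measurable]: "Z i j \<in> borel_measurable (M \<Otimes>\<^sub>M M)" if [measurable]: "i \<in> I" "j \<in> I" for i j
    unfolding Z_def by measurable
  define V where "V i j z = (of_bool (peak h i j z) :: ennreal)" for i j z
  have [measurable]: "V i j \<in> borel_measurable (M \<Otimes>\<^sub>M M)" if [measurable]: "i \<in> I" "j \<in> I" for i j
    unfolding V_def of_bool_def by measurable
  define apart where "apart i j x y = (of_bool (\<exists>k\<in>I. \<exists>l\<in>I. k \<noteq> i \<and> l \<noteq> j \<and> peak h k l (x k, y l)) :: ennreal)" for i j x y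
  define Q where "Q x y = (of_bool (\<exists>k\<in>I. \<exists>l\<in>I. peak h k l (x k, y l)) :: ennreal)" for x y
  define \<Phi> where "\<Phi> i j x y = (\<Sum>l\<in>I-{j}. V i l (x i, y l)) + (\<Sum>k\<in>I-{i}. V k j (x k, y j)) + apart i j x y" for i j x y
  have [measurable]: "case_prod (apart i j) \<in> borel_measurable (P \<Otimes>\<^sub>M P)" for i j
    unfolding apart_def of_bool_def using countable_finite[OF finite_I] by measurable
  have [measurable]: "case_prod Q \<in> borel_measurable (P \<Otimes>\<^sub>M P)"
    unfolding Q_def of_bool_def using countable_finite[OF finite_I] by measurable
  have [measurable]: "case_prod (\<Phi> i j) \<in> borel_measurable (P \<Otimes>\<^sub>M P)" if [measurable]: "i \<in> I" "j \<in> I" for i j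
    unfolding \<Phi>_def split_beta' by measurable
  define X where "X = (\<Sum>i\<in>I. \<Sum>j\<in>I. \<integral>\<^sup>+\<xi>. (\<integral>\<^sup>+\<upsilon>. Z i j (\<xi>, \<upsilon>) \<partial>M) \<partial>M)"
  have finite: "X < \<top>"
  proof -
    have "(\<integral>\<^sup>+\<xi>. (\<integral>\<^sup>+\<upsilon>. Z i j (\<xi>, \<upsilon>) \<partial>M) \<partial>M) < \<top>" if "i \<in> I" "j \<in> I" for i j
      by (rule order.strict_trans1[OF _ fin[OF that]]) (auto simp: Z_def intro!: nn_integral_mono)
    then show ?thesis unfolding X_def using finite_I by (simp add: less_top)
  qed
  have Z_le: "Z i j (x i, y j) \<le> ennreal (aggregate r h x y)" if "i \<in> I" "j \<in> I" for i j x y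
    using entry_le_aggregate[OF that, of x y] by (auto simp: Z_def intro: ennreal_leI)
  have peak_gt_1: "1 < h i j z" if "peak h i j z" for i j z
    using that row_level_ge_1[of h i "fst z"] by (auto simp: peak_def)
  have Q_le: "Q x y \<le> ennreal (aggregate r h x y)" for x y
  proof (cases "\<exists>k\<in>I. \<exists>l\<in>I. peak h k l (x k, y l)")
    case True
    then obtain k l where kl: "k \<in> I" "l \<in> I" "peak h k l (x k, y l)" by auto
    have "1 \<le> h k l (x k, y l) powr r"
      using peak_gt_1[OF kl(3)] r by (intro ge_one_powr_ge_zero) auto
    then have "1 \<le> aggregate r h x y" using entry_le_aggregate[OF kl(1,2), of x y] by linarith
    then show ?thesis by (simp add: Q_def of_bool_def)
  qed (simp add: Q_def)
  have int_Q: "(\<integral>\<^sup>+x. (\<integral>\<^sup>+y. Q x y \<partial>P) \<partial>P) \<le> ennreal (1 / 32)"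
    by (rule order_trans[OF _ S]) (intro nn_integral_mono Q_le)
  have cross: "(\<integral>\<^sup>+x. (\<integral>\<^sup>+y. Z i j (x i, y j) * \<Phi> i j x y \<partial>P) \<partial>P)
      \<le> (\<integral>\<^sup>+\<xi>. (\<integral>\<^sup>+\<upsilon>. Z i j (\<xi>, \<upsilon>) \<partial>M) \<partial>M) * ennreal (17 / 32)"
    if i [measurable]: "i \<in> I" and j [measurable]: "j \<in> I" for i j
  proof -
    have "(\<integral>\<^sup>+x. (\<integral>\<^sup>+y. Z i j (x i, y j) * \<Phi> i j x y \<partial>P) \<partial>P)
      \<le> (\<integral>\<^sup>+\<xi>. (\<integral>\<^sup>+\<upsilon>. Z i j (\<xi>, \<upsilon>) \<partial>M) \<partial>M)
        * (0 + ennreal (1 / 4) + ennreal (1 / 4) + (\<integral>\<^sup>+x. (\<integral>\<^sup>+y. Q x y \<partial>P) \<partial>P))"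
    proof (rule cross_terms[where V=V])
      fix k l z
      show "V k l z \<le> ennreal (min (h k l z / row_level h k (fst z)) 1)"
        using row_level_ge_1[of h k "fst z"]
        by (auto simp: V_def of_bool_def peak_def min_def field_simps)
      show "V k l z \<le> ennreal (min (h k l z / col_level h l (snd z)) 1)"
        using row_level_ge_1[of "transposed h" l "snd z"]
        by (auto simp: V_def of_bool_def peak_def min_def field_simps col_level_def)
    next
      fix \<xi> \<upsilon> x y
      have "(\<Sum>l\<in>I-{j}. V i l (\<xi>, (y(j := \<upsilon>)) l)) \<le> (\<Sum>l\<in>I. V i l (\<xi>, y l))"
        by (rule order_trans[OF eq_refl sum_mono2[where A="I-{j}"]]) (use finite_I in \<open>auto intro: sum.cong\<close>)
      moreover have "(\<Sum>k\<in>I-{i}. V k j ((x(i := \<xi>)) k, \<upsilon>)) \<le> (\<Sum>k\<in>I. V k j (x k, \<upsilon>))"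
        by (rule order_trans[OF eq_refl sum_mono2[where A="I-{i}"]]) (use finite_I in \<open>auto intro: sum.cong\<close>)
      moreover have "apart i j (x(i := \<xi>)) (y(j := \<upsilon>)) \<le> Q x y"
        by (auto simp: apart_def Q_def of_bool_def)
      ultimately show "\<Phi> i j (x(i := \<xi>)) (y(j := \<upsilon>))
          \<le> 0 + (\<Sum>l\<in>I. V i l (\<xi>, y l)) + (\<Sum>k\<in>I. V k j (x k, \<upsilon>)) + Q x y"
        unfolding \<Phi>_def by (simp add: add_mono)
    qed (use i j in measurable)
    also have "\<dots> \<le> (\<integral>\<^sup>+\<xi>. (\<integral>\<^sup>+\<upsilon>. Z i j (\<xi>, \<upsilon>) \<partial>M) \<partial>M)
        * (0 + ennreal (1 / 4) + ennreal (1 / 4) + ennreal (1 / 32))"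
      by (intro mult_left_mono add_mono int_Q) auto
    also have "0 + ennreal (1 / 4) + ennreal (1 / 4) + ennreal (1 / 32) = ennreal (1 / 4 + 1 / 4 + 1 / 32)"
      by (simp only: ennreal_plus add_nonneg_nonneg zero_le_one zero_le_divide_iff zero_le_numeral simp_thms add_0)
    also have "1 / 4 + 1 / 4 + 1 / 32 = (17 / 32 :: real)" by simp
    finally show ?thesis .
  qed
  \<comment> \<open>\<open>\<Phi> i j\<close> counts other peaks, so it is either zero or at least one.\<close>
  have pointwise: "(\<Sum>i\<in>I. \<Sum>j\<in>I. Z i j (x i, y j))
      \<le> ennreal (aggregate r h x y) + (\<Sum>i\<in>I. \<Sum>j\<in>I. Z i j (x i, y j) * \<Phi> i j x y)" for x y
  proof (cases "\<exists>i\<in>I. \<exists>j\<in>I. Z i j (x i, y j) \<noteq> 0 \<and> \<Phi> i j x y = 0")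
    case True
    then obtain i j where ij: "i \<in> I" "j \<in> I" "\<Phi> i j x y = 0" by auto
    have lone: "Z k l (x k, y l) = 0" if kl: "k \<in> I" "l \<in> I" "(k, l) \<noteq> (i, j)" for k l
    proof -
      have "\<not> peak h k l (x k, y l)"
        using kl ij finite_I by (cases "k = i"; cases "l = j") (auto simp: \<Phi>_def V_def apart_def)
      then show ?thesis by (simp add: Z_def)
    qed
    have "(\<Sum>i\<in>I. \<Sum>j\<in>I. Z i j (x i, y j)) = (\<Sum>l\<in>I. Z i l (x i, y l))"
      using finite_I ij lone by (subst sum.remove[of _ i]) (auto intro!: sum.neutral)
    also have "\<dots> = Z i j (x i, y j)"
      using finite_I ij lone by (subst sum.remove[of _ j]) (auto intro!: sum.neutral)
    also have "\<dots> \<le> ennreal (aggregate r h x y)" using ij by (intro Z_le)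
    finally show ?thesis by (simp add: add_increasing2)
  next
    case False
    have \<Phi>1: "1 \<le> \<Phi> i j x y" if "\<Phi> i j x y \<noteq> 0" for i j
    proof -
      have "\<exists>m. \<Phi> i j x y = of_nat m"
        unfolding \<Phi>_def V_def apart_def
        by (intro exI[of _ "(\<Sum>l\<in>I-{j}. of_bool (peak h i l (x i, y l))) + (\<Sum>k\<in>I-{i}. of_bool (peak h k j (x k, y j)))
           + of_bool (\<exists>k\<in>I. \<exists>l\<in>I. k \<noteq> i \<and> l \<noteq> j \<and> peak h k l (x k, y l))"]) simp
      then obtain m where m: "\<Phi> i j x y = of_nat m" by auto
      then show ?thesis using that by (cases m) auto
    qed
    have "Z i j (x i, y j) \<le> Z i j (x i, y j) * \<Phi> i j x y" if "i \<in> I" "j \<in> I" for i j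
      using False \<Phi>1[of i j] that mult_left_mono[of 1 "\<Phi> i j x y" "Z i j (x i, y j)"]
      by (cases "Z i j (x i, y j) = 0") auto
    then have "(\<Sum>i\<in>I. \<Sum>j\<in>I. Z i j (x i, y j)) \<le> (\<Sum>i\<in>I. \<Sum>j\<in>I. Z i j (x i, y j) * \<Phi> i j x y)"
      by (intro sum_mono)
    then show ?thesis by (simp add: add_increasing)
  qed
  have "X = (\<Sum>i\<in>I. \<Sum>j\<in>I. \<integral>\<^sup>+x. (\<integral>\<^sup>+y. Z i j (x i, y j) \<partial>P) \<partial>P)"
    unfolding X_def by (intro sum.cong refl integral_entry[symmetric]) auto
  also have "\<dots> = (\<integral>\<^sup>+x. (\<integral>\<^sup>+y. (\<Sum>i\<in>I. \<Sum>j\<in>I. Z i j (x i, y j)) \<partial>P) \<partial>P)"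
    by (rule integral_double_sum[symmetric]) measurable
  also have "\<dots> \<le> (\<integral>\<^sup>+x. (\<integral>\<^sup>+y. ennreal (aggregate r h x y) + (\<Sum>i\<in>I. \<Sum>j\<in>I. Z i j (x i, y j) * \<Phi> i j x y) \<partial>P) \<partial>P)"
    by (intro nn_integral_mono pointwise)
  also have "\<dots> = (\<integral>\<^sup>+x. (\<integral>\<^sup>+y. ennreal (aggregate r h x y) \<partial>P) \<partial>P)
      + (\<Sum>i\<in>I. \<Sum>j\<in>I. \<integral>\<^sup>+x. (\<integral>\<^sup>+y. Z i j (x i, y j) * \<Phi> i j x y \<partial>P) \<partial>P)"
    by (subst integral2_add, measurable, subst integral_double_sum, measurable)
  also have "\<dots> \<le> ennreal (1 / 32) + (\<Sum>i\<in>I. \<Sum>j\<in>I. (\<integral>\<^sup>+\<xi>. (\<integral>\<^sup>+\<upsilon>. Z i j (\<xi>, \<upsilon>) \<partial>M) \<partial>M) * ennreal (17 / 32))"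
    by (intro add_mono S sum_mono cross)
  also have "\<dots> = ennreal (1 / 32) + X * ennreal (17 / 32)"
    by (simp add: X_def sum_distrib_right)
  finally have "X \<le> ennreal ((1 / 32) / (1 - 17 / 32))"
    by (rule ennreal_absorb) (use finite in auto)
  also have "\<dots> \<le> 1" by simp
  finally show ?thesis by (simp add: X_def Z_def)
qed

text \<open>On the bulk all entries, row masses and column masses are bounded, so the second moment of the
  total bulk \<open>W\<close> is at most \<open>m (m + 3 / 2)\<close> for its mean \<open>m\<close>. The second moment method then bounds the
  integral from below by a multiple of \<open>m / (1 + m)\<close>, which is small only if \<open>m\<close> is.\<close>

lemma bulk_mass:
  assumes S: "(\<integral>\<^sup>+x. (\<integral>\<^sup>+y. ennreal (aggregate r h x y) \<partial>P) \<partial>P) \<le> ennreal (1 / 32)"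
  shows "(\<Sum>i\<in>I. \<Sum>j\<in>I. \<integral>\<^sup>+\<xi>. (\<integral>\<^sup>+\<upsilon>. ennreal (if bulk h i j (\<xi>, \<upsilon>) then h i j (\<xi>, \<upsilon>) else 0) \<partial>M) \<partial>M) \<le> 1"
proof -
  define w where "w i j z = (if bulk h i j z then h i j z else 0)" for i j z
  have [measurable]: "w i j \<in> borel_measurable (M \<Otimes>\<^sub>M M)" if [measurable]: "i \<in> I" "j \<in> I" for i j
    unfolding w_def by measurable
  have w0: "0 \<le> w i j z" and w1: "w i j z \<le> 1" for i j z
    using h_nonneg by (auto simp: w_def bulk_def)
  define W where "W x y = (\<Sum>i\<in>I. \<Sum>j\<in>I. w i j (x i, y j))" for x y
  have W [measurable]: "case_prod W \<in> borel_measurable (P \<Otimes>\<^sub>M P)"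
    unfolding W_def by measurable
  have [measurable]: "W x \<in> borel_measurable P" if "x \<in> space P" for x
    using measurable_compose_Pair1[OF that W] by simp
  have W0: "0 \<le> W x y" for x y unfolding W_def by (intro sum_nonneg w0)
  define X where "X = (\<Sum>i\<in>I. \<Sum>j\<in>I. \<integral>\<^sup>+\<xi>. (\<integral>\<^sup>+\<upsilon>. ennreal (w i j (\<xi>, \<upsilon>)) \<partial>M) \<partial>M)"
  have "X \<le> (\<Sum>i\<in>I. \<Sum>j\<in>I. \<integral>\<^sup>+\<xi>. (\<integral>\<^sup>+\<upsilon>. 1 \<partial>M) \<partial>M)"
    unfolding X_def by (intro sum_mono nn_integral_mono) (auto intro: w1)
  also have "\<dots> < \<top>" by (simp add: emeasure_space_1 ennreal_mult_less_top ennreal_of_nat_eq_real_of_nat)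
  finally obtain m where m: "0 \<le> m" "X = ennreal m" by (cases X) auto
  have W_sum: "ennreal (W x y) = (\<Sum>i\<in>I. \<Sum>j\<in>I. ennreal (w i j (x i, y j)))" for x y
    by (simp add: W_def sum_ennreal w0 sum_nonneg)
  have "(\<integral>\<^sup>+x. (\<integral>\<^sup>+y. ennreal (W x y) \<partial>P) \<partial>P) = (\<Sum>i\<in>I. \<Sum>j\<in>I. \<integral>\<^sup>+x. (\<integral>\<^sup>+y. ennreal (w i j (x i, y j)) \<partial>P) \<partial>P)"
    unfolding W_sum by (rule integral_double_sum) measurable
  also have "\<dots> = X"
    unfolding X_def by (intro sum.cong refl integral_entry) auto
  finally have mean: "(\<integral>\<^sup>+x. (\<integral>\<^sup>+y. ennreal (W x y) \<partial>P) \<partial>P) = ennreal m" using m by simp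
  have "ennreal ((W x y)\<^sup>2) = (\<Sum>i\<in>I. \<Sum>j\<in>I. ennreal (w i j (x i, y j)) * ennreal (W x y))" for x y
    using W0 by (simp add: power2_eq_square ennreal_mult' W_sum sum_distrib_right)
  then have "(\<integral>\<^sup>+x. (\<integral>\<^sup>+y. ennreal ((W x y)\<^sup>2) \<partial>P) \<partial>P)
      = (\<Sum>i\<in>I. \<Sum>j\<in>I. \<integral>\<^sup>+x. (\<integral>\<^sup>+y. ennreal (w i j (x i, y j)) * ennreal (W x y) \<partial>P) \<partial>P)"
    by (simp only:) (rule integral_double_sum, measurable)
  also have "\<dots> \<le> (\<Sum>i\<in>I. \<Sum>j\<in>I. (\<integral>\<^sup>+\<xi>. (\<integral>\<^sup>+\<upsilon>. ennreal (w i j (\<xi>, \<upsilon>)) \<partial>M) \<partial>M)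
      * (1 + ennreal (1 / 4) + ennreal (1 / 4) + (\<integral>\<^sup>+x. (\<integral>\<^sup>+y. ennreal (W x y) \<partial>P) \<partial>P)))"
  proof (intro sum_mono)
    fix i j assume i [measurable]: "i \<in> I" and j [measurable]: "j \<in> I"
    show "(\<integral>\<^sup>+x. (\<integral>\<^sup>+y. ennreal (w i j (x i, y j)) * ennreal (W x y) \<partial>P) \<partial>P)
      \<le> (\<integral>\<^sup>+\<xi>. (\<integral>\<^sup>+\<upsilon>. ennreal (w i j (\<xi>, \<upsilon>)) \<partial>M) \<partial>M)
      * (1 + ennreal (1 / 4) + ennreal (1 / 4) + (\<integral>\<^sup>+x. (\<integral>\<^sup>+y. ennreal (W x y) \<partial>P) \<partial>P))"
    proof (rule cross_terms[where V="\<lambda>k l z. ennreal (w k l z)"])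
      fix k l z
      show "ennreal (w k l z) \<le> ennreal (min (h k l z / row_level h k (fst z)) 1)"
        using row_level_ge_1[of h k "fst z"] h_nonneg
        by (intro ennreal_leI) (auto simp: w_def bulk_def)
      show "ennreal (w k l z) \<le> ennreal (min (h k l z / col_level h l (snd z)) 1)"
        using row_level_ge_1[of "transposed h" l "snd z"] h_nonneg
        by (intro ennreal_leI) (auto simp: w_def bulk_def col_level_def)
    next
      fix \<xi> \<upsilon> :: 'a and x y :: "'i \<Rightarrow> 'a"
      let ?x = "x(i := \<xi>)" and ?y = "y(j := \<upsilon>)"
      have "W ?x ?y = (\<Sum>l\<in>I. w i l (\<xi>, ?y l)) + (\<Sum>k\<in>I-{i}. \<Sum>l\<in>I. w k l (x k, ?y l))"
        unfolding W_def using finite_I i by (subst sum.remove[of _ i]) (auto intro!: sum.cong)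
      also have "(\<Sum>l\<in>I. w i l (\<xi>, ?y l)) = w i j (\<xi>, \<upsilon>) + (\<Sum>l\<in>I-{j}. w i l (\<xi>, y l))"
        using finite_I j by (subst sum.remove[of _ j]) (auto intro!: sum.cong)
      also have "(\<Sum>k\<in>I-{i}. \<Sum>l\<in>I. w k l (x k, ?y l))
          = (\<Sum>k\<in>I-{i}. w k j (x k, \<upsilon>) + (\<Sum>l\<in>I-{j}. w k l (x k, y l)))"
      proof (intro sum.cong refl)
        fix k
        show "(\<Sum>l\<in>I. w k l (x k, ?y l)) = w k j (x k, \<upsilon>) + (\<Sum>l\<in>I-{j}. w k l (x k, y l))"
          using finite_I j by (subst sum.remove[of _ j]) (auto intro!: sum.cong)
      qed
      finally have "W ?x ?y = w i j (\<xi>, \<upsilon>) + (\<Sum>l\<in>I-{j}. w i l (\<xi>, y l))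
          + (\<Sum>k\<in>I-{i}. w k j (x k, \<upsilon>)) + (\<Sum>k\<in>I-{i}. \<Sum>l\<in>I-{j}. w k l (x k, y l))"
        by (simp only: sum.distrib add.assoc)
      also have "\<dots> \<le> 1 + (\<Sum>l\<in>I. w i l (\<xi>, y l)) + (\<Sum>k\<in>I. w k j (x k, \<upsilon>)) + W x y"
      proof (intro add_mono w1)
        show "(\<Sum>l\<in>I-{j}. w i l (\<xi>, y l)) \<le> (\<Sum>l\<in>I. w i l (\<xi>, y l))"
          using finite_I w0 by (intro sum_mono2) auto
        show "(\<Sum>k\<in>I-{i}. w k j (x k, \<upsilon>)) \<le> (\<Sum>k\<in>I. w k j (x k, \<upsilon>))"
          using finite_I w0 by (intro sum_mono2) auto
        have "(\<Sum>k\<in>I-{i}. \<Sum>l\<in>I-{j}. w k l (x k, y l)) \<le> (\<Sum>k\<in>I-{i}. \<Sum>l\<in>I. w k l (x k, y l))"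
          using finite_I w0 by (intro sum_mono sum_mono2) auto
        also have "\<dots> \<le> W x y"
          unfolding W_def using finite_I w0 by (intro sum_mono2) (auto intro: sum_nonneg)
        finally show "(\<Sum>k\<in>I-{i}. \<Sum>l\<in>I-{j}. w k l (x k, y l)) \<le> W x y" .
      qed
      finally have "ennreal (W ?x ?y)
          \<le> ennreal (1 + (\<Sum>l\<in>I. w i l (\<xi>, y l)) + (\<Sum>k\<in>I. w k j (x k, \<upsilon>)) + W x y)"
        by (rule ennreal_leI)
      also have "\<dots> = 1 + (\<Sum>l\<in>I. ennreal (w i l (\<xi>, y l))) + (\<Sum>k\<in>I. ennreal (w k j (x k, \<upsilon>))) + ennreal (W x y)"
        using w0 W0 by (simp add: sum_nonneg)
      finally show "ennreal (W ?x ?y)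
          \<le> 1 + (\<Sum>l\<in>I. ennreal (w i l (\<xi>, y l))) + (\<Sum>k\<in>I. ennreal (w k j (x k, \<upsilon>))) + ennreal (W x y)" .
    qed measurable
  qed
  also have "\<dots> = ennreal m * (1 + ennreal (1 / 4) + ennreal (1 / 4) + ennreal m)"
    by (simp add: sum_distrib_right[symmetric] X_def[symmetric] m mean)
  also have "\<dots> = ennreal (m * (3 / 2 + m))"
  proof -
    have "1 + ennreal (1 / 4) + ennreal (1 / 4) + ennreal m = ennreal (1 + 1 / 4 + 1 / 4 + m)"
      using m by (simp only: ennreal_plus ennreal_1 add_nonneg_nonneg zero_le_one zero_le_divide_iff zero_le_numeral simp_thms)
    also have "1 + 1 / 4 + 1 / 4 + m = 3 / 2 + m" by simp
    finally show ?thesis using m by (simp add: ennreal_mult' del: ennreal_plus)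
  qed
  finally have second: "(\<integral>\<^sup>+x. (\<integral>\<^sup>+y. ennreal ((W x y)\<^sup>2) \<partial>P) \<partial>P) \<le> ennreal (m * (3 / 2 + m))" .
  have min_le: "min (W x y) 1 \<le> aggregate r h x y" for x y
  proof -
    have "min (W x y) 1 \<le> W x y powr r" by (rule min_one_le_powr[OF W0 r])
    also have "\<dots> \<le> aggregate r h x y"
      unfolding aggregate_def using W0 r h_nonneg
      by (intro powr_mono2) (auto simp: W_def w_def intro!: sum_mono)
    finally show ?thesis .
  qed
  define l where "l = 1 / (1 + m)"
  have l: "0 \<le> l" "l \<le> 1" using m by (auto simp: l_def field_simps)
  have "ennreal (l * m) \<le> (\<integral>\<^sup>+z. ennreal (min (case_prod W z) 1) \<partial>(P \<Otimes>\<^sub>M P)) + ennreal (l\<^sup>2 * (m * (3 / 2 + m)) / 4)"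
  proof (rule PP.mean_le_truncated_mean)
    show "(\<integral>\<^sup>+z. ennreal (case_prod W z) \<partial>(P \<Otimes>\<^sub>M P)) = ennreal m"
      using mean by (subst P.nn_integral_fst[symmetric]) auto
    show "(\<integral>\<^sup>+z. ennreal ((case_prod W z)\<^sup>2) \<partial>(P \<Otimes>\<^sub>M P)) \<le> ennreal (m * (3 / 2 + m))"
      using second by (subst P.nn_integral_fst[symmetric]) auto
  qed (use m l W0 in auto)
  also have "(\<integral>\<^sup>+z. ennreal (min (case_prod W z) 1) \<partial>(P \<Otimes>\<^sub>M P)) = (\<integral>\<^sup>+x. (\<integral>\<^sup>+y. ennreal (min (W x y) 1) \<partial>P) \<partial>P)"
    by (subst P.nn_integral_fst[symmetric]) auto
  also have "\<dots> \<le> ennreal (1 / 32)"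
    by (rule order_trans[OF _ S]) (intro nn_integral_mono ennreal_leI min_le)
  finally have "ennreal (l * m) \<le> ennreal (1 / 32) + ennreal (l\<^sup>2 * (m * (3 / 2 + m)) / 4)"
    by (simp add: add_right_mono)
  then have "l * m \<le> 1 / 32 + l\<^sup>2 * (m * (3 / 2 + m)) / 4"
    using m by (subst (asm) ennreal_plus[symmetric]) (auto simp del: ennreal_plus)
  then have "(1 + m)\<^sup>2 * (l * m) \<le> (1 + m)\<^sup>2 * (1 / 32 + l\<^sup>2 * (m * (3 / 2 + m)) / 4)"
    by (rule mult_left_mono) simp
  moreover have "(1 + m) * l = 1" using m by (simp add: l_def)
  then have "(1 + m)\<^sup>2 * (l * m) = (1 + m) * m" "(1 + m)\<^sup>2 * l\<^sup>2 = 1"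
    by (simp_all add: power2_eq_square mult.assoc[symmetric]) (simp_all add: mult.assoc mult.left_commute)
  moreover have "(1 + m)\<^sup>2 * (1 / 32 + l\<^sup>2 * (m * (3 / 2 + m)) / 4)
      = (1 + m)\<^sup>2 / 32 + ((1 + m)\<^sup>2 * l\<^sup>2) * (m * (3 / 2 + m)) / 4"
    by (simp add: algebra_simps)
  ultimately have "(1 + m) * m \<le> (1 + m)\<^sup>2 / 32 + m * (3 / 2 + m) / 4"
    by simp
  then have "m \<le> 1"
  proof (rule contrapos_pp)
    assume "\<not> m \<le> 1"
    moreover have "0 \<le> m * m" by simp
    moreover have "(1 + m) * m - ((1 + m)\<^sup>2 / 32 + m * (3 / 2 + m) / 4) = 23 / 32 * (m * m) + 9 / 16 * m - 1 / 32"
      by (simp add: power2_eq_square field_simps)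
    ultimately show "\<not> (1 + m) * m \<le> (1 + m)\<^sup>2 / 32 + m * (3 / 2 + m) / 4"
      by linarith
  qed
  then show ?thesis using m by (simp add: X_def w_def)
qed

text \<open>Below the level \<open>t\<close> an entry equals \<open>t\<close> times its truncation, so the mass of the row below
  \<open>t\<close> is at most \<open>t / 4\<close>.\<close>

lemma row_tail:
  assumes i [measurable]: "i \<in> I" and \<xi> [measurable]: "\<xi> \<in> space M"
  shows "(\<Sum>j\<in>I. \<integral>\<^sup>+\<upsilon>. ennreal (if 1 < row_level h i \<xi> \<and> h i j (\<xi>, \<upsilon>) \<le> row_level h i \<xi> then h i j (\<xi>, \<upsilon>) else 0) \<partial>M)
    \<le> ennreal (if 1 < row_level h i \<xi> then row_level h i \<xi> else 0)"
proof (cases "1 < row_level h i \<xi>")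
  case True
  define t where "t = row_level h i \<xi>"
  have t: "1 < t" using True by (simp add: t_def)
  have "(\<Sum>j\<in>I. \<integral>\<^sup>+\<upsilon>. ennreal (if h i j (\<xi>, \<upsilon>) \<le> t then h i j (\<xi>, \<upsilon>) else 0) \<partial>M)
    \<le> (\<Sum>j\<in>I. \<integral>\<^sup>+\<upsilon>. ennreal t * ennreal (min (h i j (\<xi>, \<upsilon>) / t) 1) \<partial>M)"
  proof (intro sum_mono nn_integral_mono)
    fix j \<upsilon>
    have "(if h i j (\<xi>, \<upsilon>) \<le> t then h i j (\<xi>, \<upsilon>) else 0) \<le> t * min (h i j (\<xi>, \<upsilon>) / t) 1"
      using t by (auto simp: min_def)
    then show "ennreal (if h i j (\<xi>, \<upsilon>) \<le> t then h i j (\<xi>, \<upsilon>) else 0) \<le> ennreal t * ennreal (min (h i j (\<xi>, \<upsilon>) / t) 1)"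
      using t by (subst ennreal_mult'[symmetric]) (auto intro: ennreal_leI)
  qed
  also have "\<dots> = ennreal t * row_mass h t i \<xi>"
    unfolding row_mass_def sum_distrib_left by (intro sum.cong refl nn_integral_cmult) measurable
  also have "\<dots> \<le> ennreal t * 1"
    using row_mass_at_level[OF i \<xi>] unfolding t_def[symmetric]
    by (intro mult_left_mono) (auto intro: order_trans[where y="ennreal (1 / 4)"])
  finally show ?thesis using True by (simp add: t_def)
qed simp

section \<open>Upper bounds for the integral of the aggregate\<close>

lemma aggregate_le_sum_rows: "aggregate r h x y \<le> (\<Sum>i\<in>I. (\<Sum>j\<in>I. h i j (x i, y j)) powr r)"
  unfolding aggregate_def using finite_I r h_nonneg
  by (intro powr_sum_le_sum_powr) (auto intro: sum_nonneg)

lemma integral_aggregate_le_sum: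
  "(\<integral>\<^sup>+x. (\<integral>\<^sup>+y. ennreal (aggregate r h x y) \<partial>P) \<partial>P)
    \<le> (\<Sum>i\<in>I. \<Sum>j\<in>I. \<integral>\<^sup>+\<xi>. (\<integral>\<^sup>+\<upsilon>. ennreal (h i j (\<xi>, \<upsilon>) powr r) \<partial>M) \<partial>M)"
proof -
  have le: "aggregate r h x y \<le> (\<Sum>i\<in>I. \<Sum>j\<in>I. h i j (x i, y j) powr r)" for x y
    using finite_I r h_nonneg
    by (intro order_trans[OF aggregate_le_sum_rows] sum_mono powr_sum_le_sum_powr) auto
  have "(\<integral>\<^sup>+x. (\<integral>\<^sup>+y. ennreal (aggregate r h x y) \<partial>P) \<partial>P)
    \<le> (\<integral>\<^sup>+x. (\<integral>\<^sup>+y. (\<Sum>i\<in>I. \<Sum>j\<in>I. ennreal (h i j (x i, y j) powr r)) \<partial>P) \<partial>P)"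
    using ennreal_leI[OF le] by (intro nn_integral_mono) (simp add: sum_ennreal sum_nonneg)
  also have "\<dots> = (\<Sum>i\<in>I. \<Sum>j\<in>I. \<integral>\<^sup>+x. (\<integral>\<^sup>+y. ennreal (h i j (x i, y j) powr r) \<partial>P) \<partial>P)"
    by (rule integral_double_sum) measurable
  also have "\<dots> = (\<Sum>i\<in>I. \<Sum>j\<in>I. \<integral>\<^sup>+\<xi>. (\<integral>\<^sup>+\<upsilon>. ennreal (h i j (\<xi>, \<upsilon>) powr r) \<partial>M) \<partial>M)"
    by (intro sum.cong refl integral_entry) auto
  finally show ?thesis .
qed

lemma integral_aggregate_le_ennroot:
  assumes p: "r = 1 / p"
  shows "(\<integral>\<^sup>+x. (\<integral>\<^sup>+y. ennreal (aggregate r h x y) \<partial>P) \<partial>P)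
    \<le> ennroot p (\<Sum>i\<in>I. \<Sum>j\<in>I. \<integral>\<^sup>+\<xi>. (\<integral>\<^sup>+\<upsilon>. ennreal (h i j (\<xi>, \<upsilon>)) \<partial>M) \<partial>M)"
proof -
  have p1: "1 \<le> p" using r p by (auto simp: field_simps split: if_splits)
  define Y where "Y z = (\<Sum>i\<in>I. \<Sum>j\<in>I. h i j (fst z i, snd z j))" for z
  have [measurable]: "Y \<in> borel_measurable (P \<Otimes>\<^sub>M P)" unfolding Y_def by measurable
  have Y0: "0 \<le> Y z" for z unfolding Y_def by (intro sum_nonneg h_nonneg)
  have "(\<integral>\<^sup>+x. (\<integral>\<^sup>+y. ennreal (aggregate r h x y) \<partial>P) \<partial>P) = (\<integral>\<^sup>+z. ennreal (Y z powr (1 / p)) \<partial>(P \<Otimes>\<^sub>M P))"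
    by (subst P.nn_integral_fst[symmetric]) (auto simp: aggregate_def Y_def p)
  also have "\<dots> \<le> ennroot p (\<integral>\<^sup>+z. ennreal (Y z) \<partial>(P \<Otimes>\<^sub>M P))"
    by (intro PP.powr_mean_le_ennroot Y0 p1) measurable
  also have "(\<integral>\<^sup>+z. ennreal (Y z) \<partial>(P \<Otimes>\<^sub>M P)) = (\<integral>\<^sup>+x. (\<integral>\<^sup>+y. ennreal (Y (x, y)) \<partial>P) \<partial>P)"
    by (subst P.nn_integral_fst[symmetric]) auto
  also have "\<dots> = (\<integral>\<^sup>+x. (\<integral>\<^sup>+y. (\<Sum>i\<in>I. \<Sum>j\<in>I. ennreal (h i j (x i, y j))) \<partial>P) \<partial>P)"
    by (simp add: Y_def sum_ennreal sum_nonneg h_nonneg)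
  also have "\<dots> = (\<Sum>i\<in>I. \<Sum>j\<in>I. \<integral>\<^sup>+x. (\<integral>\<^sup>+y. ennreal (h i j (x i, y j)) \<partial>P) \<partial>P)"
    by (rule integral_double_sum) measurable
  also have "\<dots> = (\<Sum>i\<in>I. \<Sum>j\<in>I. \<integral>\<^sup>+\<xi>. (\<integral>\<^sup>+\<upsilon>. ennreal (h i j (\<xi>, \<upsilon>)) \<partial>M) \<partial>M)"
    by (intro sum.cong refl integral_entry) auto
  finally show ?thesis .
qed

lemma integral_aggregate_le_rows:
  assumes p: "r = 1 / p"
  shows "(\<integral>\<^sup>+x. (\<integral>\<^sup>+y. ennreal (aggregate r h x y) \<partial>P) \<partial>P)
    \<le> (\<Sum>i\<in>I. \<integral>\<^sup>+\<xi>. ennroot p (\<Sum>j\<in>I. \<integral>\<^sup>+\<upsilon>. ennreal (h i j (\<xi>, \<upsilon>)) \<partial>M) \<partial>M)"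
proof -
  have p1: "1 \<le> p" using r p by (auto simp: field_simps split: if_splits)
  have [measurable]: "ennroot p \<in> borel_measurable borel" unfolding ennroot_def by measurable
  have inner: "(\<integral>\<^sup>+y. ennreal ((\<Sum>j\<in>I. h i j (\<xi>, y j)) powr r) \<partial>P)
      \<le> ennroot p (\<Sum>j\<in>I. \<integral>\<^sup>+\<upsilon>. ennreal (h i j (\<xi>, \<upsilon>)) \<partial>M)"
    if [measurable]: "i \<in> I" "\<xi> \<in> space M" for i \<xi>
  proof -
    have "(\<integral>\<^sup>+y. ennreal ((\<Sum>j\<in>I. h i j (\<xi>, y j)) powr (1 / p)) \<partial>P)
      \<le> ennroot p (\<integral>\<^sup>+y. ennreal (\<Sum>j\<in>I. h i j (\<xi>, y j)) \<partial>P)"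
      by (intro P.powr_mean_le_ennroot p1 sum_nonneg h_nonneg) measurable
    also have "(\<integral>\<^sup>+y. ennreal (\<Sum>j\<in>I. h i j (\<xi>, y j)) \<partial>P) = (\<Sum>j\<in>I. \<integral>\<^sup>+\<upsilon>. ennreal (h i j (\<xi>, \<upsilon>)) \<partial>M)"
      by (intro mean_row[where w="\<lambda>j \<upsilon>. h i j (\<xi>, \<upsilon>)"] h_nonneg) measurable
    finally show ?thesis by (simp add: p)
  qed
  have "(\<integral>\<^sup>+x. (\<integral>\<^sup>+y. ennreal (aggregate r h x y) \<partial>P) \<partial>P)
    \<le> (\<integral>\<^sup>+x. (\<integral>\<^sup>+y. (\<Sum>i\<in>I. ennreal ((\<Sum>j\<in>I. h i j (x i, y j)) powr r)) \<partial>P) \<partial>P)"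
    using ennreal_leI[OF aggregate_le_sum_rows] by (intro nn_integral_mono) (simp add: sum_ennreal)
  also have "\<dots> = (\<integral>\<^sup>+x. (\<Sum>i\<in>I. \<integral>\<^sup>+y. ennreal ((\<Sum>j\<in>I. h i j (x i, y j)) powr r) \<partial>P) \<partial>P)"
  proof (rule nn_integral_cong)
    fix x assume x [measurable]: "x \<in> space P"
    note [measurable] = space_component[OF x]
    show "(\<integral>\<^sup>+y. (\<Sum>i\<in>I. ennreal ((\<Sum>j\<in>I. h i j (x i, y j)) powr r)) \<partial>P)
        = (\<Sum>i\<in>I. \<integral>\<^sup>+y. ennreal ((\<Sum>j\<in>I. h i j (x i, y j)) powr r) \<partial>P)"
      by (rule nn_integral_sum) measurable
  qed
  also have "\<dots> \<le> (\<integral>\<^sup>+x. (\<Sum>i\<in>I. ennroot p (\<Sum>j\<in>I. \<integral>\<^sup>+\<upsilon>. ennreal (h i j (x i, \<upsilon>)) \<partial>M)) \<partial>P)"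
    by (intro nn_integral_mono sum_mono inner space_component)
  also have "\<dots> = (\<Sum>i\<in>I. \<integral>\<^sup>+x. ennroot p (\<Sum>j\<in>I. \<integral>\<^sup>+\<upsilon>. ennreal (h i j (x i, \<upsilon>)) \<partial>M) \<partial>P)"
    by (rule nn_integral_sum) measurable
  also have "\<dots> = (\<Sum>i\<in>I. \<integral>\<^sup>+\<xi>. ennroot p (\<Sum>j\<in>I. \<integral>\<^sup>+\<upsilon>. ennreal (h i j (\<xi>, \<upsilon>)) \<partial>M) \<partial>M)"
    by (intro sum.cong refl nn_integral_component[where g="\<lambda>\<xi>. ennroot p (\<Sum>j\<in>I. \<integral>\<^sup>+\<upsilon>. ennreal (h _ j (\<xi>, \<upsilon>)) \<partial>M)"]) measurable
  finally show ?thesis .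
qed

text \<open>The piece \<open>c\<close> of the decomposition: its row norms are at most the \<open>r\<close>-th powers of the levels,
  whose sum \<open>high_rows\<close> controls. Only an upper bound \<open>g\<close> of the entries matters, so that the
  lemma also applies, after transposition, to the piece \<open>d\<close>, which is cut down further to be
  disjoint from \<open>c\<close>.\<close>

lemma truncated_row_norm:
  assumes S: "(\<integral>\<^sup>+x. (\<integral>\<^sup>+y. ennreal (aggregate r h x y) \<partial>P) \<partial>P) \<le> ennreal (1 / 32)"
    and p: "r = 1 / p" and L: "0 < L"
    and g: "\<And>i j \<xi> \<upsilon>. i \<in> I \<Longrightarrow> j \<in> I \<Longrightarrow> g i j (\<xi>, \<upsilon>)
      \<le> L powr p * (if 1 < row_level h i \<xi> \<and> h i j (\<xi>, \<upsilon>) \<le> row_level h i \<xi> then h i j (\<xi>, \<upsilon>) else 0)"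
  shows "(\<Sum>i\<in>I. \<integral>\<^sup>+\<xi>. ennroot p (\<Sum>j\<in>I. \<integral>\<^sup>+\<upsilon>. ennreal (g i j (\<xi>, \<upsilon>)) \<partial>M) \<partial>M) \<le> ennreal L"
proof -
  have p1: "1 \<le> p" using r p by (auto simp: field_simps split: if_splits)
  have inner: "ennroot p (\<Sum>j\<in>I. \<integral>\<^sup>+\<upsilon>. ennreal (g i j (\<xi>, \<upsilon>)) \<partial>M)
      \<le> ennreal L * ennreal (if 1 < row_level h i \<xi> then row_level h i \<xi> powr r else 0)"
    if i [measurable]: "i \<in> I" and \<xi> [measurable]: "\<xi> \<in> space M" for i \<xi>
  proof -
    let ?t = "row_level h i \<xi>"
    let ?k = "\<lambda>j \<upsilon>. if 1 < ?t \<and> h i j (\<xi>, \<upsilon>) \<le> ?t then h i j (\<xi>, \<upsilon>) else 0"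
    have "(\<Sum>j\<in>I. \<integral>\<^sup>+\<upsilon>. ennreal (g i j (\<xi>, \<upsilon>)) \<partial>M)
        \<le> (\<Sum>j\<in>I. \<integral>\<^sup>+\<upsilon>. ennreal (L powr p) * ennreal (?k j \<upsilon>) \<partial>M)"
    proof (intro sum_mono nn_integral_mono)
      fix j \<upsilon> assume "j \<in> I"
      from ennreal_leI[OF g[OF i this, of \<xi> \<upsilon>]]
      show "ennreal (g i j (\<xi>, \<upsilon>)) \<le> ennreal (L powr p) * ennreal (?k j \<upsilon>)"
        by (simp only: ennreal_mult'[OF powr_ge_zero])
    qed
    also have "\<dots> = ennreal (L powr p) * (\<Sum>j\<in>I. \<integral>\<^sup>+\<upsilon>. ennreal (?k j \<upsilon>) \<partial>M)"
      unfolding sum_distrib_left by (intro sum.cong refl nn_integral_cmult) measurable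
    also have "\<dots> \<le> ennreal (L powr p) * ennreal (if 1 < ?t then ?t else 0)"
      by (intro mult_left_mono row_tail i \<xi>) simp
    also have "\<dots> = ennreal ((L * (if 1 < ?t then ?t powr r else 0)) powr p)"
      using L p p1 by (simp add: ennreal_mult'[symmetric] powr_mult powr_powr)
    finally have "ennroot p (\<Sum>j\<in>I. \<integral>\<^sup>+\<upsilon>. ennreal (g i j (\<xi>, \<upsilon>)) \<partial>M) \<le> ennreal (L * (if 1 < ?t then ?t powr r else 0))"
      using L p1 by (intro ennroot_le) auto
    also have "\<dots> = ennreal L * ennreal (if 1 < ?t then ?t powr r else 0)"
      using L by (intro ennreal_mult') simp
    finally show ?thesis .
  qed
  have "(\<Sum>i\<in>I. \<integral>\<^sup>+\<xi>. ennroot p (\<Sum>j\<in>I. \<integral>\<^sup>+\<upsilon>. ennreal (g i j (\<xi>, \<upsilon>)) \<partial>M) \<partial>M)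
      \<le> (\<Sum>i\<in>I. \<integral>\<^sup>+\<xi>. ennreal L * ennreal (if 1 < row_level h i \<xi> then row_level h i \<xi> powr r else 0) \<partial>M)"
    by (intro sum_mono nn_integral_mono inner)
  also have "\<dots> = ennreal L * (\<Sum>i\<in>I. \<integral>\<^sup>+\<xi>. ennreal (if 1 < row_level h i \<xi> then row_level h i \<xi> powr r else 0) \<partial>M)"
    unfolding sum_distrib_left by (intro sum.cong refl nn_integral_cmult) measurable
  also have "\<dots> \<le> ennreal L * 1"
    by (intro mult_left_mono high_rows S) simp
  finally show ?thesis by simp
qed

end

section \<open>The decomposition and the comparison with the infimum\<close>

text \<open>In index sets \<open>{1..n}\<close> the numeral \<open>1\<close> has to stay as it is, or else facts about them would no
  longer match after simplification.\<close>

declare One_nat_def [simp del]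

lemma random_array_norm_powr:
  fixes f :: "nat \<Rightarrow> nat \<Rightarrow> 'a \<times> 'a \<Rightarrow> 'k::{real_normed_field, banach, second_countable_topology}"
  assumes "prob_space M" "1 \<le> p" "0 \<le> L"
    and f [measurable]: "\<And>i j. i \<in> {1..n} \<Longrightarrow> j \<in> {1..n} \<Longrightarrow> f i j \<in> borel_measurable (M \<Otimes>\<^sub>M M)"
  shows "random_array M {1..n} (\<lambda>i j z. (norm (f i j z) / L) powr p) (1 / p)"
proof -
  interpret prob_space M by fact
  show ?thesis
  proof
    fix i j assume [measurable]: "i \<in> {1..n}" "j \<in> {1..n}"
    show "(\<lambda>z. (norm (f i j z) / L) powr p) \<in> borel_measurable (M \<Otimes>\<^sub>M M)" by measurable
  qed (use assms in auto)
qed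

context
  fixes M :: "'a measure" and n :: nat and p :: real
  assumes M: "prob_space M" and p: "1 \<le> p"
begin

lemma S_fun_bounds:
  fixes f :: "nat \<Rightarrow> nat \<Rightarrow> 'a \<times> 'a \<Rightarrow> 'k::{real_normed_field, banach, second_countable_topology}"
  assumes "\<And>i j. i \<in> {1..n} \<Longrightarrow> j \<in> {1..n} \<Longrightarrow> f i j \<in> borel_measurable (M \<Otimes>\<^sub>M M)"
  shows "S_fun M n p f \<le> norm_1 M n f" "S_fun M n p f \<le> norm_p M n p f"
    "S_fun M n p f \<le> norm_1_p M n p f" "S_fun M n p f \<le> norm_p_1 M n p f"
proof -
  define h where "h = (\<lambda>i j z. (norm (f i j z) / 1) powr p)"
  interpret random_array M "{1..n}" h "1 / p"
    unfolding h_def using M p assms by (intro random_array_norm_powr) auto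
  interpret T: random_array M "{1..n}" "transposed h" "1 / p" by (rule random_array_transposed)
  have S: "S_fun M n p f = (\<integral>\<^sup>+x. (\<integral>\<^sup>+y. ennreal (aggregate (1 / p) h x y) \<partial>P) \<partial>P)"
    by (simp add: S_fun_def aggregate_def h_def)
  have root: "h i j z powr (1 / p) = norm (f i j z)" for i j z
    using p by (simp add: h_def powr_powr)
  show "S_fun M n p f \<le> norm_1 M n f"
    using integral_aggregate_le_sum unfolding S root norm_1_def .
  show "S_fun M n p f \<le> norm_p M n p f"
    using integral_aggregate_le_ennroot[OF refl] unfolding S norm_p_def by (simp add: h_def)
  show "S_fun M n p f \<le> norm_1_p M n p f"
    using integral_aggregate_le_rows[OF refl] unfolding S norm_1_p_def by (simp add: h_def)
  show "S_fun M n p f \<le> norm_p_1 M n p f"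
    using T.integral_aggregate_le_rows[OF refl] unfolding S norm_p_1_def integral_aggregate_transposed
    by (simp add: h_def transposed_def)
qed

lemma S_fun_decomp_le:
  fixes f :: "nat \<Rightarrow> nat \<Rightarrow> 'a \<times> 'a \<Rightarrow> 'k::{real_normed_field, banach, second_countable_topology}"
  assumes "is_decomp M n f a b c d"
  shows "S_fun M n p f \<le> 4 * (S_fun M n p a + S_fun M n p b + S_fun M n p c + S_fun M n p d)"
proof -
  note dec = assms[unfolded is_decomp_def]
  define H where "H g i j z = (norm (g i j z) / 1) powr p" for g :: "nat \<Rightarrow> nat \<Rightarrow> 'a \<times> 'a \<Rightarrow> 'k" and i j z
  define R where "R g x y = (\<Sum>i\<in>{1..n}. \<Sum>j\<in>{1..n}. norm (g i j (x i, y j)) powr p) powr (1 / p)"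
    for g :: "nat \<Rightarrow> nat \<Rightarrow> 'a \<times> 'a \<Rightarrow> 'k" and x y
  interpret A: random_array M "{1..n}" "H a" "1 / p"
    unfolding H_def using M p dec by (intro random_array_norm_powr) auto
  interpret B: random_array M "{1..n}" "H b" "1 / p"
    unfolding H_def using M p dec by (intro random_array_norm_powr) auto
  interpret C: random_array M "{1..n}" "H c" "1 / p"
    unfolding H_def using M p dec by (intro random_array_norm_powr) auto
  interpret D: random_array M "{1..n}" "H d" "1 / p"
    unfolding H_def using M p dec by (intro random_array_norm_powr) auto
  let ?P = "Pi\<^sub>M {1..n} (\<lambda>_. M)"
  have R: "R g = A.aggregate (1 / p) (H g)" for g
    by (simp add: R_def A.aggregate_def H_def fun_eq_iff)
  have S: "S_fun M n p g = (\<integral>\<^sup>+x. (\<integral>\<^sup>+y. ennreal (R g x y) \<partial>?P) \<partial>?P)" for g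
    by (simp add: S_fun_def R_def)
  have [measurable]: "case_prod (R a) \<in> borel_measurable (?P \<Otimes>\<^sub>M ?P)" "case_prod (R b) \<in> borel_measurable (?P \<Otimes>\<^sub>M ?P)"
     "case_prod (R c) \<in> borel_measurable (?P \<Otimes>\<^sub>M ?P)" "case_prod (R d) \<in> borel_measurable (?P \<Otimes>\<^sub>M ?P)"
    unfolding R by measurable
  have R0: "0 \<le> R g x y" for g x y by (simp add: R_def)
  have pointwise: "R f x y \<le> 4 * (R a x y + R b x y + R c x y + R d x y)"
    if x: "x \<in> space ?P" and y: "y \<in> space ?P" for x y
  proof -
    define s where "s g = (\<Sum>i\<in>{1..n}. \<Sum>j\<in>{1..n}. norm (g i j (x i, y j)) powr p)" for g :: "nat \<Rightarrow> nat \<Rightarrow> 'a \<times> 'a \<Rightarrow> 'k"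
    have s0: "0 \<le> s g" for g unfolding s_def by (intro sum_nonneg) auto
    have "s f \<le> (\<Sum>i\<in>{1..n}. \<Sum>j\<in>{1..n}. 4 powr p * (norm (a i j (x i, y j)) powr p + norm (b i j (x i, y j)) powr p
          + norm (c i j (x i, y j)) powr p + norm (d i j (x i, y j)) powr p))"
      unfolding s_def
    proof (intro sum_mono)
      fix i j assume ij: "i \<in> {1..n}" "j \<in> {1..n}"
      let ?z = "(x i, y j)"
      have "?z \<in> space (M \<Otimes>\<^sub>M M)"
        using A.space_component[OF x] A.space_component[OF y] ij by (simp add: space_pair_measure)
      then have "f i j ?z = a i j ?z + b i j ?z + c i j ?z + d i j ?z" using dec ij by blast
      then have "norm (f i j ?z) \<le> norm (a i j ?z) + norm (b i j ?z) + norm (c i j ?z) + norm (d i j ?z)"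
        using norm_triangle_mono by (metis norm_triangle_ineq order_refl)
      then have "norm (f i j ?z) powr p \<le> (norm (a i j ?z) + norm (b i j ?z) + norm (c i j ?z) + norm (d i j ?z)) powr p"
        using p by (intro powr_mono2) auto
      also have "\<dots> \<le> 4 powr p * (norm (a i j ?z) powr p + norm (b i j ?z) powr p + norm (c i j ?z) powr p + norm (d i j ?z) powr p)"
        using p by (intro powr_add4_le) auto
      finally show "norm (f i j ?z) powr p \<le> \<dots>" .
    qed
    also have "\<dots> = 4 powr p * (s a + s b + s c + s d)"
      by (simp add: s_def sum.distrib sum_distrib_left distrib_left)
    finally have "s f powr (1 / p) \<le> (4 powr p * (s a + s b + s c + s d)) powr (1 / p)"
      using p s0 by (intro powr_mono2) auto
    also have "\<dots> = 4 * (s a + s b + s c + s d) powr (1 / p)"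
      using p s0 by (simp add: powr_mult powr_powr)
    also have "\<dots> \<le> 4 * (s a powr (1 / p) + s b powr (1 / p) + s c powr (1 / p) + s d powr (1 / p))"
      using p s0 by (intro mult_left_mono powr_add4_subadditive) auto
    finally show ?thesis by (simp add: R_def s_def)
  qed
  have "S_fun M n p f \<le> (\<integral>\<^sup>+x. (\<integral>\<^sup>+y. 4 * (ennreal (R a x y) + ennreal (R b x y) + ennreal (R c x y) + ennreal (R d x y)) \<partial>?P) \<partial>?P)"
    unfolding S
  proof (intro nn_integral_mono)
    fix x y assume "x \<in> space ?P" "y \<in> space ?P"
    from ennreal_leI[OF pointwise[OF this]]
    show "ennreal (R f x y) \<le> 4 * (ennreal (R a x y) + ennreal (R b x y) + ennreal (R c x y) + ennreal (R d x y))"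
      by (simp add: ennreal_mult' R0)
  qed
  also have "\<dots> = 4 * (\<integral>\<^sup>+x. (\<integral>\<^sup>+y. ennreal (R a x y) + ennreal (R b x y) + ennreal (R c x y) + ennreal (R d x y) \<partial>?P) \<partial>?P)"
    by (rule A.integral2_cmult) measurable
  also have "(\<integral>\<^sup>+x. (\<integral>\<^sup>+y. ennreal (R a x y) + ennreal (R b x y) + ennreal (R c x y) + ennreal (R d x y) \<partial>?P) \<partial>?P)
      = (\<integral>\<^sup>+x. (\<integral>\<^sup>+y. ennreal (R a x y) + ennreal (R b x y) + ennreal (R c x y) \<partial>?P) \<partial>?P) + S_fun M n p d"
    unfolding S by (rule A.integral2_add) measurable
  also have "(\<integral>\<^sup>+x. (\<integral>\<^sup>+y. ennreal (R a x y) + ennreal (R b x y) + ennreal (R c x y) \<partial>?P) \<partial>?P)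
      = (\<integral>\<^sup>+x. (\<integral>\<^sup>+y. ennreal (R a x y) + ennreal (R b x y) \<partial>?P) \<partial>?P) + S_fun M n p c"
    unfolding S by (rule A.integral2_add) measurable
  also have "(\<integral>\<^sup>+x. (\<integral>\<^sup>+y. ennreal (R a x y) + ennreal (R b x y) \<partial>?P) \<partial>?P) = S_fun M n p a + S_fun M n p b"
    unfolding S by (rule A.integral2_add) measurable
  finally show ?thesis .
qed

lemma S_fun_le_N_fun:
  fixes f :: "nat \<Rightarrow> nat \<Rightarrow> 'a \<times> 'a \<Rightarrow> 'k::{real_normed_field, banach, second_countable_topology}"
  shows "S_fun M n p f \<le> 4 * N_fun M n p f"
proof -
  have "ennreal (1 / 4) * S_fun M n p f \<le> N_fun M n p f"
    unfolding N_fun_def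
  proof (rule Inf_greatest, clarify)
    fix a b c d assume dec: "is_decomp M n f a b c d"
    have "S_fun M n p f \<le> 4 * (S_fun M n p a + S_fun M n p b + S_fun M n p c + S_fun M n p d)"
      using dec by (rule S_fun_decomp_le)
    also have "\<dots> \<le> 4 * (norm_1 M n a + norm_p M n p b + norm_1_p M n p c + norm_p_1 M n p d)"
      using dec unfolding is_decomp_def by (intro mult_left_mono add_mono S_fun_bounds) auto
    finally have "ennreal (1 / 4) * S_fun M n p f
        \<le> ennreal (1 / 4) * (ennreal 4 * (norm_1 M n a + norm_p M n p b + norm_1_p M n p c + norm_p_1 M n p d))"
      by (intro mult_left_mono) simp_all
    then show "ennreal (1 / 4) * S_fun M n p f \<le> norm_1 M n a + norm_p M n p b + norm_1_p M n p c + norm_p_1 M n p d"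
      by (subst (asm) ennreal_scale_cancel) auto
  qed
  then have "ennreal 4 * (ennreal (1 / 4) * S_fun M n p f) \<le> ennreal 4 * N_fun M n p f"
    by (rule mult_left_mono) simp
  then show ?thesis by (subst (asm) ennreal_scale_cancel) auto
qed

text \<open>The supports are cut out by the levels of the array \<open>(|f| / L)\<^sup>p\<close>. If an entry is not a peak, it
  is at most its row level or its column level; when that level is \<open>1\<close>, the entry is at most \<open>1\<close> and
  hence below the other level too. So it lies in the bulk, or below a level above \<open>1\<close>.\<close>

lemma disjoint_decomposition:
  fixes f :: "nat \<Rightarrow> nat \<Rightarrow> 'a \<times> 'a \<Rightarrow> 'k::{real_normed_field, banach, second_countable_topology}"
  assumes int: "\<And>i j. i \<in> {1..n} \<Longrightarrow> j \<in> {1..n} \<Longrightarrow> integrable (M \<Otimes>\<^sub>M M) (f i j)"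
    and \<sigma>: "0 < \<sigma>" "S_fun M n p f \<le> ennreal \<sigma>"
  obtains a b c d where "is_decomp M n f a b c d" "disjoint_supports M n a b c d"
    "norm_1 M n a \<le> ennreal (32 * \<sigma>)" "norm_p M n p b \<le> ennreal (32 * \<sigma>)"
    "norm_1_p M n p c \<le> ennreal (32 * \<sigma>)" "norm_p_1 M n p d \<le> ennreal (32 * \<sigma>)"
proof -
  define L where "L = 32 * \<sigma>"
  have L: "0 < L" using \<sigma> by (simp add: L_def)
  define h where "h = (\<lambda>i j z. (norm (f i j z) / L) powr p)"
  note f [measurable] = borel_measurable_integrable[OF int]
  interpret random_array M "{1..n}" h "1 / p"
    unfolding h_def using M p f L by (intro random_array_norm_powr) auto
  interpret T: random_array M "{1..n}" "transposed h" "1 / p" by (rule random_array_transposed)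
  have root: "h i j z powr (1 / p) = norm (f i j z) / L" for i j z
    using p L by (simp add: h_def powr_powr)
  have unroot: "norm (f i j z) powr p = L powr p * h i j z" for i j z
    using p L by (simp add: h_def powr_divide)
  have S: "(\<integral>\<^sup>+x. (\<integral>\<^sup>+y. ennreal (aggregate (1 / p) h x y) \<partial>P) \<partial>P) \<le> ennreal (1 / 32)"
  proof -
    define G where "G x y = (\<Sum>i\<in>{1..n}. \<Sum>j\<in>{1..n}. norm (f i j (x i, y j)) powr p) powr (1 / p)" for x y
    have [measurable]: "case_prod G \<in> borel_measurable (P \<Otimes>\<^sub>M P)"
      unfolding G_def by measurable
    have "aggregate (1 / p) h x y = (1 / L) * G x y" for x y
    proof -
      have "(\<Sum>i\<in>{1..n}. \<Sum>j\<in>{1..n}. h i j (x i, y j))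
          = (1 / L) powr p * (\<Sum>i\<in>{1..n}. \<Sum>j\<in>{1..n}. norm (f i j (x i, y j)) powr p)"
        using L by (simp add: h_def powr_divide sum_distrib_left)
      then show ?thesis
        using L p by (simp add: aggregate_def G_def powr_mult powr_powr sum_nonneg)
    qed
    then have "ennreal (aggregate (1 / p) h x y) = ennreal (1 / L) * ennreal (G x y)" for x y
      using L ennreal_mult'[of "1 / L" "G x y"] by simp
    then have "(\<integral>\<^sup>+x. (\<integral>\<^sup>+y. ennreal (aggregate (1 / p) h x y) \<partial>P) \<partial>P) = (\<integral>\<^sup>+x. (\<integral>\<^sup>+y. ennreal (1 / L) * ennreal (G x y) \<partial>P) \<partial>P)"
      by simp
    also have "\<dots> = ennreal (1 / L) * (\<integral>\<^sup>+x. (\<integral>\<^sup>+y. ennreal (G x y) \<partial>P) \<partial>P)"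
      by (rule integral2_cmult) measurable
    also have "(\<integral>\<^sup>+x. (\<integral>\<^sup>+y. ennreal (G x y) \<partial>P) \<partial>P) = S_fun M n p f"
      by (simp add: S_fun_def G_def)
    also have "ennreal (1 / L) * S_fun M n p f \<le> ennreal (1 / L) * ennreal \<sigma>" by (intro mult_left_mono \<sigma>(2)) simp
    also have "\<dots> = ennreal (1 / 32)"
      using \<sigma> by (subst ennreal_mult'[symmetric]) (auto simp: L_def)
    finally show ?thesis .
  qed
  have ST: "(\<integral>\<^sup>+x. (\<integral>\<^sup>+y. ennreal (aggregate (1 / p) (transposed h) x y) \<partial>P) \<partial>P) \<le> ennreal (1 / 32)"
    unfolding integral_aggregate_transposed by (rule S)
  define A where "A i j z \<longleftrightarrow> peak h i j z" for i j z
  define B where "B i j z \<longleftrightarrow> bulk h i j z" for i j z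
  define C where "C i j z \<longleftrightarrow> 1 < row_level h i (fst z) \<and> h i j z \<le> row_level h i (fst z)" for i j z
  \<comment> \<open>An entry below both its levels could go to either piece; it goes to the row piece.\<close>
  define D where "D i j z \<longleftrightarrow> 1 < col_level h j (snd z) \<and> h i j z \<le> col_level h j (snd z) \<and> \<not> C i j z" for i j z
  have lev: "1 \<le> row_level h i \<xi>" "1 \<le> col_level h i \<xi>" for i \<xi>
    unfolding col_level_def by (rule row_level_ge_1)+
  have AB: "\<not> (A i j z \<and> B i j z)" and AC: "\<not> (A i j z \<and> C i j z)" and AD: "\<not> (A i j z \<and> D i j z)"
    and BC: "\<not> (B i j z \<and> C i j z)" and BD: "\<not> (B i j z \<and> D i j z)" and CD: "\<not> (C i j z \<and> D i j z)"
    and cover: "A i j z \<or> B i j z \<or> C i j z \<or> D i j z" for i j z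
    using lev[of i "fst z"] lev[of j "snd z"]
    by (auto simp: A_def B_def C_def D_def peak_def bulk_def not_less)
  have [measurable]: "Measurable.pred (M \<Otimes>\<^sub>M M) (A i j)" "Measurable.pred (M \<Otimes>\<^sub>M M) (B i j)"
     "Measurable.pred (M \<Otimes>\<^sub>M M) (C i j)" "Measurable.pred (M \<Otimes>\<^sub>M M) (D i j)"
    if [measurable]: "i \<in> {1..n}" "j \<in> {1..n}" for i j
    unfolding A_def B_def C_def D_def by measurable
  define cut where "cut E i j z = (if E i j z then f i j z else 0)" for E :: "nat \<Rightarrow> nat \<Rightarrow> 'a \<times> 'a \<Rightarrow> bool" and i j z
  have cut_powr: "ennreal (norm (cut E i j z) powr p) = ennreal (L powr p) * ennreal (if E i j z then h i j z else 0)" for E i j z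
    using L by (simp add: cut_def unroot ennreal_mult')
  show thesis
  proof (rule that[of "cut A" "cut B" "cut C" "cut D"])
    show "is_decomp M n f (cut A) (cut B) (cut C) (cut D)"
      unfolding is_decomp_def
    proof (intro ballI conjI)
      fix i j assume [measurable]: "i \<in> {1..n}" "j \<in> {1..n}"
      show "cut A i j \<in> borel_measurable (M \<Otimes>\<^sub>M M)" "cut B i j \<in> borel_measurable (M \<Otimes>\<^sub>M M)"
        "cut C i j \<in> borel_measurable (M \<Otimes>\<^sub>M M)" "cut D i j \<in> borel_measurable (M \<Otimes>\<^sub>M M)"
        unfolding cut_def by measurable
      fix z
      show "f i j z = cut A i j z + cut B i j z + cut C i j z + cut D i j z"
        using AB[of i j z] AC[of i j z] AD[of i j z] BC[of i j z] BD[of i j z] CD[of i j z] cover[of i j z]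
        by (auto simp: cut_def)
    qed
    show "disjoint_supports M n (cut A) (cut B) (cut C) (cut D)"
      using AB AC AD BC BD CD by (auto simp: disjoint_supports_def supp_on_def cut_def split: if_splits)
    show "norm_1 M n (cut A) \<le> ennreal (32 * \<sigma>)"
    proof -
      have fin: "(\<integral>\<^sup>+\<xi>. (\<integral>\<^sup>+\<upsilon>. ennreal (h i j (\<xi>, \<upsilon>) powr (1 / p)) \<partial>M) \<partial>M) < \<top>"
        if [measurable]: "i \<in> {1..n}" "j \<in> {1..n}" for i j
      proof -
        have "(\<integral>\<^sup>+\<xi>. (\<integral>\<^sup>+\<upsilon>. ennreal (h i j (\<xi>, \<upsilon>) powr (1 / p)) \<partial>M) \<partial>M)
            = (\<integral>\<^sup>+z. ennreal (norm (f i j z) / L) \<partial>(M \<Otimes>\<^sub>M M))"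
          unfolding root by (subst nn_integral_fst[symmetric]) auto
        also have "\<dots> = (\<integral>\<^sup>+z. ennreal (1 / L) * ennreal (norm (f i j z)) \<partial>(M \<Otimes>\<^sub>M M))"
          using L by (simp add: ennreal_mult'[symmetric])
        also have "\<dots> = ennreal (1 / L) * (\<integral>\<^sup>+z. ennreal (norm (f i j z)) \<partial>(M \<Otimes>\<^sub>M M))"
          by (rule nn_integral_cmult) measurable
        also have "\<dots> < \<top>"
          using int[OF that] by (simp add: integrable_iff_bounded ennreal_mult_less_top)
        finally show ?thesis .
      qed
      have "ennreal (norm (cut A i j z)) = ennreal L * ennreal (if peak h i j z then h i j z powr (1 / p) else 0)" for i j z
        using L by (simp add: cut_def A_def root ennreal_mult'[symmetric])
      then have "norm_1 M n (cut A) = (\<Sum>i\<in>{1..n}. \<Sum>j\<in>{1..n}.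
          \<integral>\<^sup>+\<xi>. (\<integral>\<^sup>+\<upsilon>. ennreal L * ennreal (if peak h i j (\<xi>, \<upsilon>) then h i j (\<xi>, \<upsilon>) powr (1 / p) else 0) \<partial>M) \<partial>M)"
        by (simp only: norm_1_def)
      also have "\<dots> = ennreal L * (\<Sum>i\<in>{1..n}. \<Sum>j\<in>{1..n}.
          \<integral>\<^sup>+\<xi>. (\<integral>\<^sup>+\<upsilon>. ennreal (if peak h i j (\<xi>, \<upsilon>) then h i j (\<xi>, \<upsilon>) powr (1 / p) else 0) \<partial>M) \<partial>M)"
        unfolding sum_distrib_left by (intro sum.cong refl entry_integral_cmult) measurable
      also have "\<dots> \<le> ennreal L * 1"
        by (intro mult_left_mono peaks S fin) auto
      finally show ?thesis by (simp add: L_def)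
    qed
    show "norm_p M n p (cut B) \<le> ennreal (32 * \<sigma>)"
    proof -
      have "(\<Sum>i\<in>{1..n}. \<Sum>j\<in>{1..n}. \<integral>\<^sup>+\<xi>. (\<integral>\<^sup>+\<upsilon>. ennreal (norm (cut B i j (\<xi>, \<upsilon>)) powr p) \<partial>M) \<partial>M)
        = ennreal (L powr p) * (\<Sum>i\<in>{1..n}. \<Sum>j\<in>{1..n}.
          \<integral>\<^sup>+\<xi>. (\<integral>\<^sup>+\<upsilon>. ennreal (if bulk h i j (\<xi>, \<upsilon>) then h i j (\<xi>, \<upsilon>) else 0) \<partial>M) \<partial>M)"
        unfolding sum_distrib_left cut_powr B_def by (intro sum.cong refl entry_integral_cmult) measurable
      also have "\<dots> \<le> ennreal (L powr p) * 1"
        by (intro mult_left_mono bulk_mass S) simp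
      finally show ?thesis
        unfolding norm_p_def L_def[symmetric] using L p by (intro ennroot_le) auto
    qed
    show "norm_1_p M n p (cut C) \<le> ennreal (32 * \<sigma>)"
      unfolding norm_1_p_def L_def[symmetric]
      by (rule truncated_row_norm[where g="\<lambda>i j z. norm (cut C i j z) powr p", OF S refl L])
        (simp add: cut_def C_def unroot)
    show "norm_p_1 M n p (cut D) \<le> ennreal (32 * \<sigma>)"
      unfolding norm_p_1_def L_def[symmetric]
      using T.truncated_row_norm[where g="\<lambda>j i z. norm (cut D i j (snd z, fst z)) powr p", OF ST refl L]
        h_nonneg
      by (simp add: cut_def D_def unroot transposed_def col_level_def)
  qed
qed

text \<open>The decomposition is available for every \<open>\<sigma> > S(f)\<close>, which also covers \<open>S(f) = 0\<close>; four
  norms of at most \<open>32 \<sigma>\<close> give the constant \<open>128\<close>.\<close>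

lemma N_fun_le_S_fun:
  fixes f :: "nat \<Rightarrow> nat \<Rightarrow> 'a \<times> 'a \<Rightarrow> 'k::{real_normed_field, banach, second_countable_topology}"
  assumes int: "\<And>i j. i \<in> {1..n} \<Longrightarrow> j \<in> {1..n} \<Longrightarrow> integrable (M \<Otimes>\<^sub>M M) (f i j)"
  shows "N_fun M n p f \<le> ennreal 128 * S_fun M n p f"
proof (cases "S_fun M n p f")
  case (real s)
  show ?thesis
  proof (rule ennreal_le_epsilon)
    fix e :: real assume e: "0 < e"
    define \<sigma> where "\<sigma> = s + e / 128"
    have \<sigma>: "0 < \<sigma>" "S_fun M n p f \<le> ennreal \<sigma>"
      using real e by (auto simp: \<sigma>_def intro: ennreal_leI)
    obtain a b c d where dec: "is_decomp M n f a b c d" and "disjoint_supports M n a b c d"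
      and le: "norm_1 M n a \<le> ennreal (32 * \<sigma>)" "norm_p M n p b \<le> ennreal (32 * \<sigma>)"
        "norm_1_p M n p c \<le> ennreal (32 * \<sigma>)" "norm_p_1 M n p d \<le> ennreal (32 * \<sigma>)"
      by (rule disjoint_decomposition[OF int \<sigma>])
    have "N_fun M n p f \<le> norm_1 M n a + norm_p M n p b + norm_1_p M n p c + norm_p_1 M n p d"
      unfolding N_fun_def using dec by (intro Inf_lower) blast
    also have "\<dots> \<le> ennreal (32 * \<sigma>) + ennreal (32 * \<sigma>) + ennreal (32 * \<sigma>) + ennreal (32 * \<sigma>)"
      by (intro add_mono le)
    also have "\<dots> = ennreal (128 * s + e)"
      using \<sigma> by (simp add: ennreal_plus[symmetric] \<sigma>_def del: ennreal_plus)
    also have "\<dots> = ennreal 128 * S_fun M n p f + ennreal e"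
      using real e by (simp add: ennreal_mult')
    finally show "N_fun M n p f \<le> ennreal 128 * S_fun M n p f + ennreal e" .
  qed
qed (simp add: ennreal_mult_top)

end

theorem theorem2:
  shows "\<exists>C::real. 1 \<le> C \<and> C \<le> abs_const_ceiling \<and>
    (\<forall>(M :: 'a measure) (n :: nat) (p :: real)
       (f :: nat \<Rightarrow> nat \<Rightarrow> 'a \<times> 'a \<Rightarrow> 'k::{real_normed_field, banach, second_countable_topology}).
       prob_space M \<longrightarrow> 1 \<le> p \<longrightarrow>
       (\<forall>i\<in>{1..n}. \<forall>j\<in>{1..n}. integrable (M \<Otimes>\<^sub>M M) (f i j)) \<longrightarrow>
         ennreal (1 / C) * N_fun M n p f \<le> S_fun M n p f \<and>
         S_fun M n p f \<le> ennreal C * N_fun M n p f \<and>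
         (S_fun M n p f \<le> 1 \<longrightarrow>
            (\<exists>a b c d. is_decomp M n f a b c d \<and>
               norm_1 M n a \<le> ennreal C \<and> norm_p M n p b \<le> ennreal C \<and>
               norm_1_p M n p c \<le> ennreal C \<and> norm_p_1 M n p d \<le> ennreal C \<and>
               disjoint_supports M n a b c d)))"
proof (rule exI[of _ 128], intro conjI allI impI)
  show "(1::real) \<le> 128" by simp
  show "(128::real) \<le> abs_const_ceiling" by (simp add: abs_const_ceiling_def)
next
  fix M :: "'a measure" and n :: nat and p :: real and f :: "nat \<Rightarrow> nat \<Rightarrow> 'a \<times> 'a \<Rightarrow> 'k"
  assume M: "prob_space M" and p: "1 \<le> p"
    and f: "\<forall>i\<in>{1..n}. \<forall>j\<in>{1..n}. integrable (M \<Otimes>\<^sub>M M) (f i j)"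
  have "ennreal (1 / 128) * N_fun M n p f \<le> ennreal (1 / 128) * (ennreal 128 * S_fun M n p f)"
    using N_fun_le_S_fun[OF M p, of n f] f by (intro mult_left_mono) auto
  then show "ennreal (1 / 128) * N_fun M n p f \<le> S_fun M n p f"
    by (subst (asm) ennreal_scale_cancel) auto
  have "S_fun M n p f \<le> 4 * N_fun M n p f" by (rule S_fun_le_N_fun[OF M p])
  also have "\<dots> \<le> ennreal 128 * N_fun M n p f" by (intro mult_right_mono) auto
  finally show "S_fun M n p f \<le> ennreal 128 * N_fun M n p f" .
  assume "S_fun M n p f \<le> 1"
  then have S: "S_fun M n p f \<le> ennreal 1" by simp
  have int: "integrable (M \<Otimes>\<^sub>M M) (f i j)" if "i \<in> {1..n}" "j \<in> {1..n}" for i j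
    using f that by blast
  obtain a b c d where "is_decomp M n f a b c d" "disjoint_supports M n a b c d"
    and le: "norm_1 M n a \<le> ennreal (32 * 1)" "norm_p M n p b \<le> ennreal (32 * 1)"
      "norm_1_p M n p c \<le> ennreal (32 * 1)" "norm_p_1 M n p d \<le> ennreal (32 * 1)"
    by (rule disjoint_decomposition[OF M p int zero_less_one S])
  moreover have "ennreal (32 * 1) \<le> ennreal 128" by (intro ennreal_leI) simp
  ultimately show "\<exists>a b c d. is_decomp M n f a b c d \<and>
      norm_1 M n a \<le> ennreal 128 \<and> norm_p M n p b \<le> ennreal 128 \<and>
      norm_1_p M n p c \<le> ennreal 128 \<and> norm_p_1 M n p d \<le> ennreal 128 \<and>
      disjoint_supports M n a b c d"
    by (blast intro: order_trans)
qed

end
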